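(* Let $0<\theta_0\le\pi$, let $\Omega=\{(r\cos\theta,r\sin\theta):r>0,\ |\theta|<\theta_0\}$, and let $u$ be the minimal solution of $-\Delta\varphi=\mathrm{e}^{-\varphi}$ in $\Omega$, $\varphi=0$ on $\partial\Omega$. Then, for every $r>0$, the map $\theta\mapsto u(r,\theta)$ achieves its maximum at $\theta=0$.
   Context: The minimal solution $u$ is defined by $u(\boldsymbol{x})=\sup_{R>0}u_R(\boldsymbol{x})$, where, with $\Omega_R=\{\boldsymbol{x}\in\Omega:|\boldsymbol{x}|<R\}$, $u_R\in H^1_0(\Omega_R)$ is the unique (positive) variational solution of $-\Delta u_R=\mathrm{e}^{-u_R}$ in $\Omega_R$, $u_R=0$ on $\partial\Omega_R$ (nondecreasing in $R$). It is a non-negative local variational solution of the problem and lies below every other one, where a local variational solution is a function $\varphi$ with $\varphi\in H^1(\mathcal{O})$ for every bounded open $\mathcal{O}\subset\Omega$, zero trace on $\partial\Omega$, and $\int_\Omega\nabla\varphi\cdot\nabla v=\int_\Omega\mathrm{e}^{-\varphi}v$ for all $v\in H^1_0(\Omega)$ with bounded support. *)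

theory Defs
  imports "HOL-Analysis.Analysis"
begin

section \<open>Test functions\<close>

fun Ck :: "nat \<Rightarrow> ('a::euclidean_space \<Rightarrow> real) \<Rightarrow> bool" where
  "Ck 0 f \<longleftrightarrow> continuous_on UNIV f"
| "Ck (Suc k) f \<longleftrightarrow>
     (\<forall>x. f differentiable (at x)) \<and>
     (\<forall>b\<in>Basis. Ck k (\<lambda>x. frechet_derivative f (at x) b))"

definition test_functions :: "'a::euclidean_space set \<Rightarrow> ('a \<Rightarrow> real) set" where
  "test_functions U = {\<phi>. (\<forall>k. Ck k \<phi>) \<and>
     compact (closure {x. \<phi> x \<noteq> 0}) \<and> closure {x. \<phi> x \<noteq> 0} \<subseteq> U}"

definition grad :: "('a::euclidean_space \<Rightarrow> real) \<Rightarrow> 'a \<Rightarrow> 'a" where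
  "grad \<phi> x = (\<Sum>b\<in>Basis. frechet_derivative \<phi> (at x) b *\<^sub>R b)"

section \<open>Sobolev spaces\<close>

text \<open>
  Elements of the function spaces are represented by functions on the whole space, of which only
  the values on \<open>U\<close> matter, and are not identified when they agree almost everywhere.
\<close>

definition L2_on :: "'a::euclidean_space set \<Rightarrow> ('a \<Rightarrow> 'b::euclidean_space) \<Rightarrow> bool" where
  "L2_on U f \<longleftrightarrow> set_borel_measurable lborel U f \<and>
     set_integrable lborel U (\<lambda>x. (norm (f x))\<^sup>2)"

definition locally_integrable_on ::
    "('a::euclidean_space \<Rightarrow> 'b::euclidean_space) \<Rightarrow> 'a set \<Rightarrow> bool" where
  "locally_integrable_on f U \<longleftrightarrow> (\<forall>K. compact K \<and> K \<subseteq> U \<longrightarrow> set_integrable lborel K f)"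

definition has_weak_gradient ::
    "'a::euclidean_space set \<Rightarrow> ('a \<Rightarrow> real) \<Rightarrow> ('a \<Rightarrow> 'a) \<Rightarrow> bool" where
  "has_weak_gradient U f g \<longleftrightarrow>
     locally_integrable_on f U \<and> locally_integrable_on g U \<and>
     (\<forall>\<phi>\<in>test_functions U. \<forall>b\<in>Basis.
        (LINT x:U|lborel. f x * (grad \<phi> x \<bullet> b)) = - (LINT x:U|lborel. (g x \<bullet> b) * \<phi> x))"

text \<open>\<open>H10 U\<close> is the closure of the test functions in the norm of \<open>H\<^sup>1(U)\<close>.\<close>

definition H10 :: "'a::euclidean_space set \<Rightarrow> ('a \<Rightarrow> real) set" where
  "H10 U = {f. L2_on U f \<and> (\<exists>g. has_weak_gradient U f g \<and> L2_on U g \<and>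
     (\<exists>\<phi>. (\<forall>n::nat. \<phi> n \<in> test_functions U) \<and>
        (\<lambda>n. LINT x:U|lborel. (\<phi> n x - f x)\<^sup>2) \<longlonglongrightarrow> 0 \<and>
        (\<lambda>n. LINT x:U|lborel. (norm (grad (\<phi> n) x - g x))\<^sup>2) \<longlonglongrightarrow> 0))}"

section \<open>The minimal solution\<close>

text \<open>
  Weak gradients are unique up to null sets, so quantifying universally over them below amounts to
  speaking of the weak gradient; they exist for members of \<open>H10 U\<close>. The integrability of
  \<open>exp (- u x) * v x\<close> has to be demanded because a non-integrable function has integral \<open>0\<close>.
\<close>

definition variational_solution :: "'a::euclidean_space set \<Rightarrow> ('a \<Rightarrow> real) \<Rightarrow> bool" where
  "variational_solution U u \<longleftrightarrow> u \<in> H10 U \<and>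
     (\<forall>v\<in>H10 U. \<forall>g h. has_weak_gradient U u g \<and> has_weak_gradient U v h \<longrightarrow>
        set_integrable lborel U (\<lambda>x. exp (- u x) * v x) \<and>
        (LINT x:U|lborel. g x \<bullet> h x) = (LINT x:U|lborel. exp (- u x) * v x))"

definition truncated :: "'a::euclidean_space set \<Rightarrow> real \<Rightarrow> 'a set" where
  "truncated \<Omega> R = {x \<in> \<Omega>. norm x < R}"

text \<open>
  Variational solutions in \<open>truncated \<Omega> R\<close> are unique (and positive) up to null sets. Pointwise
  values are those of the representative that is continuous in the open set \<open>truncated \<Omega> R\<close>,
  extended by \<open>0\<close>. Taking the supremum in \<^typ>\<open>ereal\<close> makes its finiteness part of the definition.
\<close>

definition minimal_solution :: "'a::euclidean_space set \<Rightarrow> ('a \<Rightarrow> real) \<Rightarrow> bool" where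
  "minimal_solution \<Omega> u \<longleftrightarrow>
     (\<exists>U :: real \<Rightarrow> 'a \<Rightarrow> real.
        (\<forall>R>0. variational_solution (truncated \<Omega> R) (U R) \<and>
               continuous_on (truncated \<Omega> R) (U R) \<and>
               (\<forall>x. x \<notin> truncated \<Omega> R \<longrightarrow> U R x = 0)) \<and>
        (\<forall>x\<in>\<Omega>. ereal (u x) = (SUP R\<in>{0<..}. ereal (U R x))))"

section \<open>Plane sectors\<close>

definition polar :: "real \<Rightarrow> real \<Rightarrow> real^2" where
  "polar r \<theta> = vector [r * cos \<theta>, r * sin \<theta>]"

definition sector :: "real \<Rightarrow> (real^2) set" where
  "sector \<theta>\<^sub>0 = {polar r \<theta> | r \<theta>. r > 0 \<and> \<bar>\<theta>\<bar> < \<theta>\<^sub>0}"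

end

theory Submission
  imports Defs
begin

text \<open>
  Let \<open>0 < \<theta> < \<theta>\<^sub>0\<close> and let \<open>\<rho>\<close> be the reflection in the bisector of the angles \<open>0\<close> and \<open>\<theta>\<close>. It
  maps the part \<open>S\<close> of the truncated sector beyond the bisector into the truncated sector. On \<open>S\<close>,
  the function \<open>w = u - u \<circ> \<rho>\<close> is nonpositive on the boundary and satisfies
  \<open>- \<Delta>w = exp (- u) - exp (- u \<circ> \<rho>)\<close>, which is negative where \<open>w > 0\<close>; testing with a function of
  the positive part of \<open>w\<close> gives \<open>w \<le> 0\<close>. As \<open>\<rho>\<close> exchanges the two angles, this is the claim.

  Instead of the positive part, the test functions use \<open>flat 0 t = exp (- 1 / t)\<close>, so that
  inserting smooth approximations of \<open>u\<close> directly yields smooth compactly supported functions, and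
  neither mollification nor a chain rule in Sobolev spaces is needed.
\<close>

section \<open>Smooth functions\<close>

text \<open>The approximations shape the proof. Test functions \<open>\<phi> n\<close> tending to
  \<open>u\<close> need not be nonnegative, and a function of
  \<open>\<phi> n - \<phi> n \<circ> \<rho>\<close> need not have its support inside
  \<open>S\<close>: the difference is zero on the mirror and may be positive on the outer boundary,
  wherever the reflected value is negative. A margin \<open>e > 0\<close> repairs this: a positive
  function of \<open>\<phi> n \<circ> \<rho>\<close> that exceeds its argument is subtracted
  instead. In the limit this function must act as a mere shift by \<open>e\<close>, since otherwise
  the gradient terms would not form a square. It is a shift only on nonnegative values, so
  \<open>0 \<le> u\<close> has to be known beforehand; this also bounds \<open>exp (- u)\<close> by
  1. The margin disappears at the end by letting \<open>e\<close> tend to zero. All inequalities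
  obtained by testing hold almost everywhere, and continuity of the representatives turns them into
  pointwise ones.\<close>

lemma grad_inner_Basis:
  assumes "b \<in> Basis"
  shows "grad f x \<bullet> b = frechet_derivative f (at x) b"
  using assms by (simp add: grad_def inner_sum_left inner_Basis if_distrib cong: if_cong)

lemma GDERIV_grad:
  assumes "f differentiable (at x)"
  shows "GDERIV f x :> grad f x"
proof -
  have d: "(f has_derivative frechet_derivative f (at x)) (at x)"
    using assms by (simp add: frechet_derivative_works)
  then have lin: "linear (frechet_derivative f (at x))"
    by (rule has_derivative_linear)
  have "frechet_derivative f (at x) h = h \<bullet> grad f x" for h
  proof -
    have "frechet_derivative f (at x) h = frechet_derivative f (at x) (\<Sum>b\<in>Basis. (h \<bullet> b) *\<^sub>R b)"
      by (simp add: euclidean_representation)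
    also have "\<dots> = h \<bullet> grad f x"
      by (simp add: lin linear_sum linear_scale grad_def inner_sum_right mult.commute)
    finally show ?thesis .
  qed
  then have "frechet_derivative f (at x) = (\<lambda>h. h \<bullet> grad f x)"
    by blast
  with d show ?thesis
    by (simp add: gderiv_def)
qed

lemma grad_eqI:
  assumes "GDERIV f x :> v"
  shows "grad f x = v"
proof (rule euclidean_eqI)
  fix b :: 'a assume b: "b \<in> Basis"
  have "(\<lambda>h. h \<bullet> v) = frechet_derivative f (at x)"
    using assms frechet_derivative_at unfolding gderiv_def by metis
  then have "frechet_derivative f (at x) b = b \<bullet> v"
    by metis
  with b show "grad f x \<bullet> b = v \<bullet> b"
    by (metis grad_inner_Basis inner_commute)
qed

text \<open>Turns smoothness into a recursion on gradients: once a gradient is exhibited, its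
  components remain to be treated. They are built from functions of the same kinds, so the closure
  properties below follow by induction on \<open>k\<close> with the functions left
  arbitrary.\<close>

lemma Ck_SucI:
  assumes "\<And>x. GDERIV f x :> g x" and "\<And>b. b \<in> Basis \<Longrightarrow> Ck k (\<lambda>x. g x \<bullet> b)"
  shows "Ck (Suc k) f"
proof -
  have d: "f differentiable (at x)" for x
    using assms(1) unfolding gderiv_def differentiable_def by blast
  have "frechet_derivative f (at x) b = g x \<bullet> b" if "b \<in> Basis" for x b
    using grad_inner_Basis[OF that] grad_eqI[OF assms(1)] by metis
  with d assms(2) show ?thesis by simp
qed

lemma Ck_SucD:
  assumes "Ck (Suc k) f"
  shows "GDERIV f x :> grad f x" and "b \<in> Basis \<Longrightarrow> Ck k (\<lambda>x. grad f x \<bullet> b)"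
  using assms by (simp_all add: GDERIV_grad grad_inner_Basis)

lemma Ck_Suc_imp: "Ck (Suc k) f \<Longrightarrow> Ck k f"
proof (induction k arbitrary: f)
  case 0
  then show ?case
    by (auto intro!: continuous_at_imp_continuous_on differentiable_imp_continuous_within)
next
  case (Suc k)
  show ?case
    by (rule Ck_SucI[OF Ck_SucD(1)[OF Suc.prems]]) (rule Suc.IH[OF Ck_SucD(2)[OF Suc.prems]])
qed

lemma Ck_continuous: "Ck k f \<Longrightarrow> continuous_on UNIV f"
proof (induction k)
  case (Suc k)
  then show ?case using Ck_Suc_imp by blast
qed simp

lemma Ck_const: "Ck k (\<lambda>x. c)"
proof (induction k arbitrary: c)
  case (Suc k)
  show ?case
    by (rule Ck_SucI[where g = "\<lambda>x. 0"]) (use Suc in \<open>simp_all add: GDERIV_const\<close>)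
qed simp

lemma Ck_add: "Ck k f \<Longrightarrow> Ck k g \<Longrightarrow> Ck k (\<lambda>x. f x + g x)"
proof (induction k arbitrary: f g)
  case (Suc k)
  show ?case
    by (rule Ck_SucI[OF GDERIV_add[OF Ck_SucD(1)[OF Suc.prems(1)] Ck_SucD(1)[OF Suc.prems(2)]]])
      (simp add: inner_add_left Suc.IH Ck_SucD(2)[OF Suc.prems(1)] Ck_SucD(2)[OF Suc.prems(2)])
qed (simp add: continuous_on_add)

lemma Ck_mult: "Ck k f \<Longrightarrow> Ck k g \<Longrightarrow> Ck k (\<lambda>x. f x * g x)"
proof (induction k arbitrary: f g)
  case (Suc k)
  show ?case
  proof (rule Ck_SucI[OF GDERIV_mult[OF Ck_SucD(1)[OF Suc.prems(1)] Ck_SucD(1)[OF Suc.prems(2)]]])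
    fix b :: 'a assume "b \<in> Basis"
    then show "Ck k (\<lambda>x. (f x *\<^sub>R grad g x + g x *\<^sub>R grad f x) \<bullet> b)"
      using Suc.IH[OF Ck_Suc_imp[OF Suc.prems(1)] Ck_SucD(2)[OF Suc.prems(2)]]
        Suc.IH[OF Ck_Suc_imp[OF Suc.prems(2)] Ck_SucD(2)[OF Suc.prems(1)]]
      by (simp add: inner_add_left Ck_add)
  qed
qed (simp add: continuous_on_mult)

lemma Ck_sum: "finite A \<Longrightarrow> (\<And>i. i \<in> A \<Longrightarrow> Ck k (f i)) \<Longrightarrow> Ck k (\<lambda>x. \<Sum>i\<in>A. f i x)"
  by (induction A rule: finite_induct) (simp_all add: Ck_const Ck_add)

lemma Ck_cmult: "Ck k f \<Longrightarrow> Ck k (\<lambda>x. c * f x)"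
  by (simp add: Ck_mult Ck_const)

lemma Ck_diff: "Ck k f \<Longrightarrow> Ck k g \<Longrightarrow> Ck k (\<lambda>x. f x - g x)"
  using Ck_add[OF _ Ck_cmult[of k g "-1"]] by simp

section \<open>Composition with an orthogonal involution\<close>

lemma orthogonal_involution_adjoint:
  fixes \<rho> :: "'a::euclidean_space \<Rightarrow> 'a"
  assumes "orthogonal_transformation \<rho>" and "\<And>x. \<rho> (\<rho> x) = x"
  shows "\<rho> x \<bullet> y = x \<bullet> \<rho> y"
  using assms by (metis orthogonal_transformation_def)

text \<open>By the chain rule the derivative is \<open>\<lambda>h. \<rho> h \<bullet> v\<close>. An
  orthogonal involution is its own adjoint, which moves \<open>\<rho>\<close> onto
  \<open>v\<close>.\<close>

lemma GDERIV_orthogonal_involution: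
  fixes \<rho> :: "'a::euclidean_space \<Rightarrow> 'a"
  assumes "orthogonal_transformation \<rho>" and "\<And>x. \<rho> (\<rho> x) = x"
    and "GDERIV f (\<rho> x) :> v"
  shows "GDERIV (\<lambda>x. f (\<rho> x)) x :> \<rho> v"
proof -
  have "(\<rho> has_derivative \<rho>) (at x)"
    by (intro linear_imp_has_derivative orthogonal_transformation_linear assms(1))
  from has_derivative_compose[OF this, of f "\<lambda>h. h \<bullet> v"] assms(3)
  show ?thesis
    by (simp add: gderiv_def orthogonal_involution_adjoint[OF assms(1,2)])
qed

lemma Ck_orthogonal_involution:
  fixes \<rho> :: "'a::euclidean_space \<Rightarrow> 'a"
  assumes "orthogonal_transformation \<rho>" and "\<And>x. \<rho> (\<rho> x) = x" and "Ck k f"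
  shows "Ck k (\<lambda>x. f (\<rho> x))"
  using assms(3)
proof (induction k arbitrary: f)
  case 0
  have "continuous_on UNIV \<rho>"
    using assms(1) by (metis linear_continuous_on linear_conv_bounded_linear
        orthogonal_transformation_linear)
  with 0 show ?case
    using continuous_on_compose2[of UNIV f UNIV \<rho>] by simp
next
  case (Suc k)
  show ?case
  proof (rule Ck_SucI[OF GDERIV_orthogonal_involution[OF assms(1,2) Ck_SucD(1)[OF Suc.prems]]])
    fix b :: 'a assume "b \<in> Basis"
    have "\<rho> (grad f (\<rho> x)) \<bullet> b = (\<Sum>c\<in>Basis. (\<rho> b \<bullet> c) * (grad f (\<rho> x) \<bullet> c))" for x
      by (simp add: orthogonal_involution_adjoint[OF assms(1,2)] euclidean_inner[of _ "\<rho> b"] mult.commute)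
    then show "Ck k (\<lambda>x. \<rho> (grad f (\<rho> x)) \<bullet> b)"
      using Suc.IH[OF Ck_SucD(2)[OF Suc.prems]] by (simp add: Ck_sum Ck_cmult)
  qed
qed

section \<open>Restriction to an open set, extended by zero\<close>

lemma GDERIV_cong_open:
  assumes "GDERIV f x :> v" and "open A" and "x \<in> A" and "\<And>y. y \<in> A \<Longrightarrow> f y = g y"
  shows "GDERIV g x :> v"
  using assms has_derivative_transform_within_open unfolding gderiv_def by blast

text \<open>The open sets \<open>S\<close> and \<open>- C\<close> cover the space. On
  \<open>S\<close> the product is \<open>f\<close>, and on \<open>- C\<close> it is zero, so the
  jump of the indicator does no harm.\<close>

lemma GDERIV_indicator:
  assumes "open S" and "closed C" and "C \<subseteq> S" and "\<And>x. x \<in> S - C \<Longrightarrow> f x = 0"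
    and "GDERIV f x :> v"
  shows "GDERIV (\<lambda>x. indicator S x * f x) x :> indicator S x *\<^sub>R v"
proof (cases "x \<in> S")
  case True
  then show ?thesis
    using GDERIV_cong_open[OF assms(5,1), of "\<lambda>x. indicator S x * f x"] by simp
next
  case False
  have "indicator S y * f y = 0" if "y \<in> - C" for y
    using assms(4)[of y] that by (cases "y \<in> S") auto
  then show ?thesis
    using GDERIV_cong_open[OF GDERIV_const, of "- C" x 0 "\<lambda>x. indicator S x * f x"]
      assms(2,3) False by auto
qed

lemma grad_eq_0_open:
  assumes "open A" and "x \<in> A" and "\<And>y. y \<in> A \<Longrightarrow> f y = 0"
  shows "grad f x = 0"
  by (rule grad_eqI, rule GDERIV_cong_open[OF GDERIV_const assms(1,2)]) (simp add: assms(3))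

lemma Ck_indicator:
  assumes "open S" and "closed C" and "C \<subseteq> S"
    and "\<And>x. x \<in> S - C \<Longrightarrow> f x = 0" and "Ck k f"
  shows "Ck k (\<lambda>x. indicator S x * f x)"
  using assms(4,5)
proof (induction k arbitrary: f)
  case 0
  have "continuous_on S (\<lambda>x. indicator S x * f x)"
    by (rule continuous_on_eq[of S f]) (use 0 in \<open>auto intro: continuous_on_subset\<close>)
  moreover have "continuous_on (- C) (\<lambda>x. indicator S x * f x)"
    by (rule continuous_on_eq[of "- C" "\<lambda>_. 0"]) (use 0 in \<open>auto simp: indicator_def\<close>)
  ultimately have "continuous_on (S \<union> - C) (\<lambda>x. indicator S x * f x)"
    using assms(1,2) by (intro continuous_on_open_Un) auto
  moreover have "S \<union> - C = UNIV"
    using assms(3) by auto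
  ultimately show ?case by simp
next
  case (Suc k)
  show ?case
  proof (rule Ck_SucI[OF GDERIV_indicator[OF assms(1,2,3) Suc.prems(1) Ck_SucD(1)[OF Suc.prems(2)]]])
    fix b :: 'a assume "b \<in> Basis"
    \<comment> \<open>As \<open>S - C\<close> is open, the gradient inherits the vanishing there,
      and the induction hypothesis applies to its components.\<close>
    have "grad f x = 0" if "x \<in> S - C" for x
      by (rule grad_eq_0_open[of "S - C"]) (use assms Suc.prems that in auto)
    then have "Ck k (\<lambda>x. indicator S x * (grad f x \<bullet> b))"
      by (intro Suc.IH Ck_SucD(2)[OF Suc.prems(2)] \<open>b \<in> Basis\<close>) auto
    then show "Ck k (\<lambda>x. (indicator S x *\<^sub>R grad f x) \<bullet> b)" by simp
  qed auto
qed

section \<open>A flat function\<close>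

text \<open>The powers in the denominator make the linear span of the family closed under
  differentiation, so that a single induction proves smoothness of all its members.\<close>

definition flat :: "nat \<Rightarrow> real \<Rightarrow> real" where
  "flat m t = (if t \<le> 0 then 0 else exp (- (1 / t)) / t ^ m)"

lemma flat_nonneg: "0 \<le> flat m t"
  by (simp add: flat_def)

lemma flat_eq_0: "t \<le> 0 \<Longrightarrow> flat m t = 0"
  by (simp add: flat_def)

lemma flat_pos: "0 < t \<Longrightarrow> 0 < flat m t"
  by (simp add: flat_def)

lemma flat_0_le_1: "flat 0 t \<le> 1"
  by (simp add: flat_def)

lemma mult_flat_Suc: "t * flat (Suc m) t = flat m t"
  by (simp add: flat_def)

text \<open>Keeping only the term of degree \<open>m + j\<close> in the series of
  \<open>exp (1 / t)\<close> bounds \<open>exp (- (1 / t))\<close> by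
  \<open>fact (m + j) * t ^ (m + j)\<close>; dividing by \<open>t ^ m\<close> leaves
  \<open>t ^ j\<close>.\<close>

lemma flat_le_power:
  assumes "0 \<le> t"
  shows "flat m t \<le> fact (m + j) * t ^ j"
proof (cases "t = 0")
  case False
  with assms have t: "t > 0" by simp
  have "(\<Sum>n\<in>{m + j}. (1/t) ^ n /\<^sub>R fact n) \<le> (\<Sum>n. (1/t) ^ n /\<^sub>R fact n)"
    using t by (intro sum_le_suminf summable_exp_generic) auto
  then have "(1/t) ^ (m + j) /\<^sub>R fact (m + j) \<le> exp (1/t)"
    by (simp add: exp_def)
  then have "exp (- (1 / t)) \<le> fact (m + j) * t ^ (m + j)"
    using t by (simp add: exp_minus field_simps power_add)
  with t show ?thesis
    by (simp add: flat_def field_simps power_add)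
qed (simp add: flat_def)

lemma flat_has_derivative:
  "(flat m has_real_derivative flat (m + 2) t - m * flat (Suc m) t) (at t)"
proof -
  consider "t < 0" | "t = 0" | "t > 0" by linarith
  then show ?thesis
  proof cases
    case 1
    have "(flat m has_real_derivative 0) (at t)"
      by (rule has_field_derivative_transform_within_open[OF DERIV_const[of 0], of "{..<0}"])
        (use 1 in \<open>auto simp: flat_def\<close>)
    with 1 show ?thesis by (simp add: flat_def)
  next
    case 2
    \<comment> \<open>This is the difference quotient at 0. The power bound with
      \<open>j = 2\<close> leaves a factor \<open>h\<close> to spare.\<close>
    have "((\<lambda>h. flat m h / h) \<longlongrightarrow> 0) (at 0)"
    proof (rule Lim_null_comparison)
      show "\<forall>\<^sub>F h in at 0. norm (flat m h / h) \<le> fact (m + 2) * \<bar>h\<bar>"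
      proof (rule always_eventually, rule allI)
        fix h :: real
        show "norm (flat m h / h) \<le> fact (m + 2) * \<bar>h\<bar>"
        proof (cases "h > 0")
          case True
          then have "flat m h \<le> fact (m + 2) * \<bar>h\<bar> * h"
            using flat_le_power[of h m 2] by (simp add: power2_eq_square mult.assoc del: fact_Suc)
          with True show ?thesis
            using flat_nonneg[of m h] by (simp add: pos_divide_le_eq del: fact_Suc)
        next
          case False
          then have z: "flat m h = 0" by (simp add: flat_eq_0)
          show ?thesis unfolding z by simp
        qed
      qed
      show "((\<lambda>h::real. fact (m + 2) * \<bar>h\<bar>) \<longlongrightarrow> 0) (at 0)"
        by (auto intro!: tendsto_eq_intros)
    qed
    with 2 show ?thesis by (simp add: DERIV_def flat_def)
  next
    case 3
    \<comment> \<open>For \<open>t > 0\<close>, \<open>flat m t\<close> is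
      \<open>exp (- y) * y ^ m\<close> at \<open>y = 1 / t\<close>. For \<open>m = 0\<close> the
      truncated exponent \<open>m - Suc 0\<close> is multiplied by
      \<open>real m = 0\<close>.\<close>
    have "((\<lambda>x. exp (- x) * x ^ m) has_real_derivative
        (- exp (- y) * y ^ m + real m * y ^ (m - Suc 0) * exp (- y))) (at y)" for y :: real
      by (auto intro!: derivative_eq_intros)
    from DERIV_chain2[OF this DERIV_inverse[of t UNIV]] 3
    have "((\<lambda>t. exp (- inverse t) * inverse t ^ m) has_real_derivative
        (- exp (- inverse t) * inverse t ^ m + real m * inverse t ^ (m - Suc 0) * exp (- inverse t))
          * - (inverse t ^ Suc (Suc 0))) (at t)"
      by blast
    moreover have "real m * inverse t ^ (m - Suc 0) * inverse t = real m * inverse t ^ m"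
      by (cases m) auto
    then have "(- exp (- inverse t) * inverse t ^ m + real m * inverse t ^ (m - Suc 0) * exp (- inverse t))
          * - (inverse t ^ Suc (Suc 0))
        = exp (- inverse t) * inverse t ^ (m + 2) - real m * inverse t ^ m * inverse t * exp (- inverse t)"
      by (simp add: ring_distribs power2_eq_square) (metis mult.assoc mult.commute)
    moreover have "\<dots> = flat (m + 2) t - m * flat (Suc m) t"
      using 3 by (simp add: flat_def inverse_eq_divide power_divide)
    ultimately have "((\<lambda>t. exp (- inverse t) * inverse t ^ m) has_real_derivative
        flat (m + 2) t - m * flat (Suc m) t) (at t)"
      by metis
    then show ?thesis
      by (rule has_field_derivative_transform_within_open[of _ _ _ "{0<..}"])
        (use 3 in \<open>auto simp: flat_def inverse_eq_divide power_divide\<close>)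
  qed
qed

lemma Ck_flat:
  assumes "Ck k f"
  shows "Ck k (\<lambda>x. flat m (f x))"
  using assms
proof (induction k arbitrary: m)
  case 0
  have "continuous_on UNIV (flat m)"
    using flat_has_derivative by (meson DERIV_isCont continuous_at_imp_continuous_on)
  with 0 show ?case
    using continuous_on_compose2[of UNIV "flat m" UNIV f] by simp
next
  case (Suc k)
  show ?case
  proof (rule Ck_SucI[OF GDERIV_DERIV_compose[OF Ck_SucD(1)[OF Suc.prems] flat_has_derivative]])
    fix b :: 'a assume "b \<in> Basis"
    then show "Ck k (\<lambda>x. ((flat (m + 2) (f x) - m * flat (Suc m) (f x)) *\<^sub>R grad f x) \<bullet> b)"
      by (simp add: Ck_mult Ck_diff Ck_cmult Suc.IH[OF Ck_Suc_imp[OF Suc.prems]]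
          Ck_SucD(2)[OF Suc.prems] del: add_2_eq_Suc')
  qed
qed

lemma flat_2_le_2: "flat 2 t \<le> 2"
  using flat_le_power[of t 2 0] by (cases "0 \<le> t") (auto simp: flat_eq_0)

text \<open>\<open>lift e\<close> is smooth and positive, lies above the identity and equals \<open>t + e\<close> for \<open>t \<ge> 0\<close>;
  \<open>lift' e\<close> is its derivative.\<close>

definition lift :: "real \<Rightarrow> real \<Rightarrow> real" where
  "lift e t = t + e - t * flat 0 (- t / e)"

definition lift' :: "real \<Rightarrow> real \<Rightarrow> real" where
  "lift' e t = 1 - flat 0 (- t / e) - flat 1 (- t / e)"

lemma lift_nonneg_arg: "0 < e \<Longrightarrow> 0 \<le> t \<Longrightarrow> lift e t = t + e"
  by (simp add: lift_def flat_eq_0)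

lemma lift'_nonneg_arg: "0 < e \<Longrightarrow> 0 \<le> t \<Longrightarrow> lift' e t = 1"
  by (simp add: lift'_def flat_eq_0)

lemma lift_gt:
  assumes "0 < e"
  shows "t < lift e t"
proof -
  have "t * flat 0 (- t / e) \<le> 0"
    using assms flat_nonneg by (cases "t \<ge> 0") (auto simp: flat_eq_0 mult_le_0_iff)
  with assms show ?thesis by (simp add: lift_def)
qed

text \<open>Squaring the tangent bound \<open>1 - x / 2 \<le> exp (- (x / 2))\<close> gains the term
  \<open>x * x / 4\<close>, hence strictness.\<close>

lemma one_minus_less_exp:
  fixes x :: real
  assumes "0 < x"
  shows "1 - x < exp (- x)"
proof (cases "x < 1")
  case True
  have "1 - x < (1 - x / 2)\<^sup>2"
    using assms by (simp add: power2_eq_square algebra_simps)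
  also have "\<dots> \<le> (exp (- (x / 2)))\<^sup>2"
    using exp_ge_add_one_self[of "- (x / 2)"] True by (intro power_mono) auto
  also have "\<dots> = exp (- x)"
    by (simp flip: exp_of_nat_mult)
  finally show ?thesis .
next
  case False
  have "0 < exp (- x)" by simp
  with False show ?thesis by linarith
qed

text \<open>For \<open>t < 0\<close> and \<open>s = - t / e\<close> one has
  \<open>lift e t = e * s * (exp (- (1 / s)) - (1 - 1 / s))\<close>, so positivity is the strict
  exponential bound at \<open>1 / s\<close>.\<close>

lemma lift_pos:
  assumes "0 < e"
  shows "0 < lift e t"
proof (cases "0 \<le> t")
  case False
  with assms have s: "0 < - t / e" by (simp add: divide_neg_pos)
  have "1 - 1 / (- t / e) < exp (- (1 / (- t / e)))"
    by (rule one_minus_less_exp) (use s in \<open>rule divide_pos_pos[OF zero_less_one]\<close>)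
  then have "1 + e / t < flat 0 (- t / e)"
    using s False by (simp add: flat_def)
  then have "t * flat 0 (- t / e) < t * (1 + e / t)"
    using False by (simp add: mult_less_cancel_left)
  with False show ?thesis by (simp add: lift_def algebra_simps)
qed (use assms in \<open>simp add: lift_nonneg_arg\<close>)

lemma lift_has_derivative:
  assumes "0 < e"
  shows "(lift e has_real_derivative lift' e t) (at t)"
proof -
  have "((\<lambda>t. flat 0 (- t / e)) has_real_derivative flat 2 (- t / e) * (- 1 / e)) (at t)"
  proof (rule DERIV_chain2[where f = "flat 0" and g = "\<lambda>t. - t / e"])
    show "(flat 0 has_real_derivative flat 2 (- t / e)) (at (- t / e))"
      using flat_has_derivative[of 0 "- t / e"] by (simp add: numeral_2_eq_2)
    show "((\<lambda>t. - t / e) has_real_derivative - 1 / e) (at t)"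
      by (rule DERIV_cdivide) (rule DERIV_minus[OF DERIV_ident])
  qed
  note * = DERIV_diff[OF DERIV_add[OF DERIV_ident DERIV_const[of e]] DERIV_mult[OF DERIV_ident this]]
  have "flat 2 (- t / e) * (- 1 / e) * t = (- t / e) * flat (Suc 1) (- t / e)"
    by (simp add: numeral_2_eq_2)
  also have "\<dots> = flat 1 (- t / e)"
    by (rule mult_flat_Suc)
  finally have "1 + 0 - (1 * flat 0 (- t / e) + flat 2 (- t / e) * (- 1 / e) * t) = lift' e t"
    unfolding lift'_def by linarith
  from DERIV_cong[OF * this] show ?thesis
    unfolding lift_def .
qed

text \<open>One unit for each of the three terms. A uniform bound is needed because
  \<open>lift'\<close> multiplies the reflected gradients when limits are taken.\<close>

lemma abs_lift'_le: "\<bar>lift' e t\<bar> \<le> 3"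
proof -
  have "flat 1 (- t / e) \<le> 1"
    using flat_le_power[of "- t / e" 1 0] by (cases "0 \<le> - t / e") (auto simp: flat_eq_0)
  then show ?thesis
    using flat_0_le_1[of "- t / e"] flat_nonneg[of 0 "- t / e"] flat_nonneg[of 1 "- t / e"]
    by (simp add: lift'_def)
qed

lemma Ck_lift: "Ck k f \<Longrightarrow> Ck k (\<lambda>x. lift e (f x))"
  using Ck_cmult[of k f "- 1 / e"]
  unfolding lift_def
  by (intro Ck_diff Ck_add Ck_const Ck_mult Ck_flat) auto

section \<open>Test functions and integration by parts\<close>

lemma test_functionsI:
  assumes "\<And>k. Ck k \<phi>" and "compact K" and "K \<subseteq> U" and "\<And>x. x \<notin> K \<Longrightarrow> \<phi> x = 0"
  shows "\<phi> \<in> test_functions U"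
proof -
  have "closure {x. \<phi> x \<noteq> 0} \<subseteq> K"
    using assms(2,4) by (intro closure_minimal) (auto intro: compact_imp_closed)
  moreover from this have "compact (closure {x. \<phi> x \<noteq> 0})"
    using assms(2) compact_Int_closed[OF assms(2) closed_closure, of "{x. \<phi> x \<noteq> 0}"]
    by (simp add: Int_absorb1)
  ultimately show ?thesis
    using assms by (auto simp: test_functions_def)
qed

lemma test_functions_Ck: "\<phi> \<in> test_functions U \<Longrightarrow> Ck k \<phi>"
  by (simp add: test_functions_def)

lemma test_functions_GDERIV: "\<phi> \<in> test_functions U \<Longrightarrow> GDERIV \<phi> x :> grad \<phi> x"
  using Ck_SucD(1)[OF test_functions_Ck] .

lemma test_functions_continuous: "\<phi> \<in> test_functions U \<Longrightarrow> continuous_on UNIV \<phi>"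
  using Ck_continuous[OF test_functions_Ck] .

lemma test_functions_continuous_grad:
  assumes "\<phi> \<in> test_functions U"
  shows "continuous_on UNIV (grad \<phi>)"
  using Ck_continuous[OF Ck_SucD(2)[OF test_functions_Ck[OF assms]]]
  by (rule continuous_on_componentwise[THEN iffD2, rule_format])

lemma test_functions_support:
  assumes "\<phi> \<in> test_functions U"
  shows "\<exists>K. compact K \<and> K \<subseteq> U \<and> (\<forall>x. x \<notin> K \<longrightarrow> \<phi> x = 0 \<and> grad \<phi> x = 0)"
proof (intro exI conjI allI impI)
  let ?K = "closure {x. \<phi> x \<noteq> 0}"
  show "compact ?K" "?K \<subseteq> U"
    using assms by (auto simp: test_functions_def)
  show z: "\<phi> x = 0" if "x \<notin> ?K" for x
    using subsetD[OF closure_subset CollectI] that by metis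
  show "grad \<phi> x = 0" if "x \<notin> ?K" for x
  proof (rule grad_eq_0_open)
    show "open (- ?K)" by (rule open_Compl[OF closed_closure])
    show "x \<in> - ?K" unfolding Compl_iff by (rule that)
    show "\<phi> y = 0" if "y \<in> - ?K" for y using that by (intro z) (rule ComplD)
  qed
qed

lemma test_functions_outside:
  assumes "\<phi> \<in> test_functions U" and "x \<notin> U"
  shows "\<phi> x = 0" and "grad \<phi> x = 0"
  using test_functions_support[OF assms(1)] assms(2) by blast+

lemma continuous_compact_support_integrable:
  fixes f :: "'a::euclidean_space \<Rightarrow> 'b::euclidean_space"
  assumes "continuous_on UNIV f" and "compact K" and "\<And>x. x \<notin> K \<Longrightarrow> f x = 0"
  shows "integrable lborel f"
proof -
  have eq: "(\<lambda>x. indicator K x *\<^sub>R f x) = f"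
    using assms(3) by (auto simp: indicator_def fun_eq_iff)
  have "integrable lborel (\<lambda>x. indicator K x *\<^sub>R f x)"
    using assms by (intro borel_integrable_compact) (auto intro: continuous_on_subset)
  then show ?thesis by (simp only: eq)
qed

section \<open>Translations and integration by parts\<close>

lemma integral_translation:
  fixes f :: "'a::euclidean_space \<Rightarrow> real"
  assumes "f \<in> borel_measurable borel"
  shows "(LINT x|lborel. f (c + x)) = (LINT x|lborel. f x)"
  using integral_distr[of "(+) c" lborel borel f] assms by (simp add: lborel_distr_plus)

lemma integrable_translation:
  fixes f :: "'a::euclidean_space \<Rightarrow> real"
  assumes "integrable lborel f"
  shows "integrable lborel (\<lambda>x. f (c + x))"
  using integrable_distr_eq[of "(+) c" lborel borel f] assms
  by (simp add: lborel_distr_plus borel_measurable_integrable)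

text \<open>Translation invariance makes the integrals of the difference quotients vanish.\<close>

lemma integral_directional_derivative_eq_0:
  fixes f :: "'a::euclidean_space \<Rightarrow> real"
  assumes D: "\<And>x. GDERIV f x :> g x" and g: "continuous_on UNIV g"
    and K: "compact K" and f0: "\<And>x. x \<notin> K \<Longrightarrow> f x = 0" and g0: "\<And>x. x \<notin> K \<Longrightarrow> g x = 0"
  shows "(LINT x|lborel. g x \<bullet> b) = 0"
proof -
  define t :: "nat \<Rightarrow> real" where "t n = 1 / real (Suc n)" for n
  have t: "0 < t n" "t n \<le> 1" for n
    by (auto simp: t_def)
  have tlim: "t \<longlonglongrightarrow> 0"
    unfolding t_def using LIMSEQ_inverse_real_of_nat by (simp add: inverse_eq_divide)
  have fc: "continuous_on UNIV f"
    using D unfolding gderiv_def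
    by (intro continuous_at_imp_continuous_on ballI has_derivative_continuous) auto
  have fm [measurable]: "f \<in> borel_measurable borel"
    using fc by (rule borel_measurable_continuous_onI)
  have gm [measurable]: "g \<in> borel_measurable borel"
    using g by (rule borel_measurable_continuous_onI)
  obtain r where "\<forall>x\<in>K. norm x \<le> r"
    using compact_imp_bounded[OF K] unfolding bounded_iff by blast
  then have r: "K \<subseteq> cball 0 r"
    by auto
  obtain M where M: "norm (g x) \<le> M" for x
  proof -
    have "bounded (g ` K)"
      by (rule compact_imp_bounded[OF compact_continuous_image[OF continuous_on_subset[OF g subset_UNIV] K]])
    then obtain B where B: "\<forall>x\<in>K. norm (g x) \<le> B"
      by (auto simp: bounded_iff)
    have "norm (g x) \<le> max B 0" for x
      using g0[of x] B by (cases "x \<in> K") (simp_all add: le_max_iff_disj)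
    then show thesis by (rule that)
  qed
  have lip: "\<bar>f y - f x\<bar> \<le> M * norm (y - x)" for x y
  proof -
    have "norm (f y - f x) \<le> M * norm (y - x)"
    proof (rule differentiable_bound)
      show "(f has_derivative (\<lambda>h. h \<bullet> g z)) (at z within UNIV)" for z
        using D[of z] by (simp add: gderiv_def)
      show "onorm (\<lambda>h. h \<bullet> g z) \<le> M" for z
      proof (rule onorm_le)
        fix h
        have "norm (h \<bullet> g z) \<le> norm h * norm (g z)"
          using Cauchy_Schwarz_ineq2[of h "g z"] by simp
        also have "\<dots> \<le> M * norm h"
          using M[of z] by (subst mult.commute) (rule mult_right_mono[OF _ norm_ge_zero])
        finally show "norm (h \<bullet> g z) \<le> M * norm h" .
      qed
    qed auto
    then show ?thesis by simp
  qed
  have fint: "integrable lborel f"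
    using continuous_compact_support_integrable[OF fc K f0] by simp
  let ?h = "\<lambda>n x. (f (t n *\<^sub>R b + x) - f x) / t n"
  \<comment> \<open>Since \<open>t n \<le> 1\<close>, all difference quotients vanish outside the
    ball enlarged by \<open>norm b\<close>; inside it the Lipschitz bound applies.\<close>
  let ?w = "\<lambda>x. indicator (cball 0 (r + norm b)) x * (M * norm b) :: real"
  have "(\<lambda>n. LINT x|lborel. ?h n x) \<longlonglongrightarrow> (LINT x|lborel. g x \<bullet> b)"
  proof (rule integral_dominated_convergence[where w = ?w])
    show "integrable lborel ?w"
      using emeasure_bounded_finite[OF bounded_cball, of 0 "r + norm b"]
      by (intro integrable_mult_left integrable_real_indicator) simp_all
    show "AE x in lborel. (\<lambda>n. ?h n x) \<longlonglongrightarrow> g x \<bullet> b"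
    proof (rule AE_I2)
      fix x
      have "((\<lambda>s. f (s *\<^sub>R b + x)) has_derivative (\<lambda>s. (s *\<^sub>R b) \<bullet> g x)) (at 0)"
        by (rule has_derivative_compose[where f = "\<lambda>s. s *\<^sub>R b + x" and g = f and g' = "\<lambda>h. h \<bullet> g x"])
          (use D[of x] in \<open>auto intro!: derivative_eq_intros simp: gderiv_def\<close>)
      then have "((\<lambda>s. f (s *\<^sub>R b + x)) has_real_derivative g x \<bullet> b) (at 0)"
        by (simp add: has_field_derivative_def inner_commute mult_commute_abs)
      then have "((\<lambda>s. (f (s *\<^sub>R b + x) - f x) / s) \<longlongrightarrow> g x \<bullet> b) (at 0)"
        by (simp add: DERIV_def)
      moreover have "filterlim t (at 0) sequentially"
        using tlim by (intro filterlim_atI) (auto intro!: always_eventually simp: t_def)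
      ultimately show "(\<lambda>n. ?h n x) \<longlonglongrightarrow> g x \<bullet> b"
        by (rule filterlim_compose)
    qed
    show "AE x in lborel. norm (?h n x) \<le> ?w x" for n
    proof (rule AE_I2)
      fix x
      have "M \<ge> 0" using M[of 0] norm_ge_zero order_trans by blast
      show "norm (?h n x) \<le> ?w x"
      proof (cases "x \<in> cball 0 (r + norm b)")
        case True
        have "\<bar>f (t n *\<^sub>R b + x) - f x\<bar> \<le> M * norm b * t n"
          using lip[of "t n *\<^sub>R b + x" x] t(1)[of n] by (simp add: ac_simps)
        with True t(1)[of n] show ?thesis
          by (simp add: pos_divide_le_eq)
      next
        case False
        then have x: "norm x > r + norm b" by simp
        have "norm (t n *\<^sub>R b) \<le> norm b"
          using t[of n] by (simp add: mult_left_le_one_le)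
        then have "norm (t n *\<^sub>R b + x) > r"
          using norm_triangle_ineq4[of "t n *\<^sub>R b + x" "t n *\<^sub>R b"] x by simp
        then have "f (t n *\<^sub>R b + x) = 0"
          using r by (intro f0) auto
        moreover have "norm x > r"
          using x norm_ge_zero[of b] by linarith
        then have "f x = 0"
          using r by (intro f0) auto
        ultimately show ?thesis using False by simp
      qed
    qed
  qed measurable
  moreover have "(LINT x|lborel. ?h n x) = 0" for n
    using fint integrable_translation[OF fint, of "t n *\<^sub>R b"]
    by (simp add: integral_translation)
  ultimately have "(\<lambda>n. 0) \<longlonglongrightarrow> (LINT x|lborel. g x \<bullet> b)"
    by (simp only:)
  then show ?thesis
    by (simp add: LIMSEQ_const_iff)
qed

text \<open>The product of \<open>f\<close> and \<open>\<phi>\<close> has compact support, so its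
  directional derivatives integrate to zero; the product rule turns this into integration by
  parts.\<close>

lemma has_weak_gradient_test_function:
  assumes "f \<in> test_functions U"
  shows "has_weak_gradient U f (grad f)"
  unfolding has_weak_gradient_def
proof (intro conjI ballI)
  show "locally_integrable_on f U" "locally_integrable_on (grad f) U"
    unfolding locally_integrable_on_def set_integrable_def
    using borel_integrable_compact[OF _ continuous_on_subset[OF test_functions_continuous[OF assms] subset_UNIV]]
      borel_integrable_compact[OF _ continuous_on_subset[OF test_functions_continuous_grad[OF assms] subset_UNIV]]
    by blast+
  fix \<phi> and b :: 'a assume \<phi>: "\<phi> \<in> test_functions U"
  obtain K where K: "compact K" "K \<subseteq> U" "\<And>x. x \<notin> K \<Longrightarrow> \<phi> x = 0" "\<And>x. x \<notin> K \<Longrightarrow> grad \<phi> x = 0"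
    using test_functions_support[OF \<phi>] by metis
  note cont = test_functions_continuous[OF assms] test_functions_continuous_grad[OF assms]
     test_functions_continuous[OF \<phi>] test_functions_continuous_grad[OF \<phi>]
  have int1: "integrable lborel (\<lambda>x. f x * (grad \<phi> x \<bullet> b))"
    and int2: "integrable lborel (\<lambda>x. (grad f x \<bullet> b) * \<phi> x)"
    by (rule continuous_compact_support_integrable[OF _ K(1)];
        use K cont in \<open>auto intro!: continuous_intros\<close>)+
  have "(LINT x|lborel. (f x *\<^sub>R grad \<phi> x + \<phi> x *\<^sub>R grad f x) \<bullet> b) = 0"
    by (rule integral_directional_derivative_eq_0[OF GDERIV_mult[OF test_functions_GDERIV[OF assms]
            test_functions_GDERIV[OF \<phi>]] _ K(1)])
      (use K cont in \<open>auto intro!: continuous_intros\<close>)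
  then have "(LINT x|lborel. f x * (grad \<phi> x \<bullet> b)) + (LINT x|lborel. (grad f x \<bullet> b) * \<phi> x) = 0"
    using int1 int2 by (simp add: inner_add_left mult.commute)
  moreover have "(LINT x:U|lborel. f x * (grad \<phi> x \<bullet> b)) = (LINT x|lborel. f x * (grad \<phi> x \<bullet> b))"
    unfolding set_lebesgue_integral_def using test_functions_outside[OF \<phi>]
    by (intro Bochner_Integration.integral_cong) (auto simp: indicator_def)
  moreover have "(LINT x:U|lborel. (grad f x \<bullet> b) * \<phi> x) = (LINT x|lborel. (grad f x \<bullet> b) * \<phi> x)"
    unfolding set_lebesgue_integral_def using test_functions_outside[OF \<phi>]
    by (intro Bochner_Integration.integral_cong) (auto simp: indicator_def)
  ultimately show "(LINT x:U|lborel. f x * (grad \<phi> x \<bullet> b)) = - (LINT x:U|lborel. (grad f x \<bullet> b) * \<phi> x)"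
    by linarith
qed

section \<open>Test functions as members of \<open>H10\<close>\<close>

lemma L2_on_continuous_compact_support:
  fixes f :: "'a::euclidean_space \<Rightarrow> 'b::euclidean_space"
  assumes "U \<in> sets borel" and "continuous_on UNIV f" and "compact K" and "\<And>x. x \<notin> K \<Longrightarrow> f x = 0"
  shows "L2_on U f"
proof -
  have [measurable]: "f \<in> borel_measurable borel"
    using assms(2) by (rule borel_measurable_continuous_onI)
  have "integrable lborel (\<lambda>x. (norm (f x))\<^sup>2)"
    by (rule continuous_compact_support_integrable[OF _ assms(3)])
      (use assms in \<open>auto intro!: continuous_intros\<close>)
  then show ?thesis
    using assms(1) integrable_mult_indicator[of U lborel "\<lambda>x. (norm (f x))\<^sup>2"]
    by (simp add: L2_on_def set_borel_measurable_def set_integrable_def)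
qed

lemma test_functions_H10:
  assumes "U \<in> sets borel" and "\<phi> \<in> test_functions U"
  shows "\<phi> \<in> H10 U"
proof -
  obtain K where K: "compact K" "K \<subseteq> U" "\<And>x. x \<notin> K \<Longrightarrow> \<phi> x = 0" "\<And>x. x \<notin> K \<Longrightarrow> grad \<phi> x = 0"
    using test_functions_support[OF assms(2)] by metis
  have "L2_on U \<phi>" "L2_on U (grad \<phi>)"
    using L2_on_continuous_compact_support[OF assms(1) _ K(1)] K
      test_functions_continuous[OF assms(2)] test_functions_continuous_grad[OF assms(2)] by auto
  then show ?thesis
    unfolding H10_def using has_weak_gradient_test_function[OF assms(2)] assms(2)
    by (auto intro!: exI[of _ "grad \<phi>"] exI[of _ "\<lambda>_. \<phi>"])
qed

section \<open>Limits of integrals\<close>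

text \<open>Young's inequality with a free weight. A good choice of \<open>d\<close> lets it do the
  work of the Cauchy-Schwarz inequality for integrals.\<close>

lemma two_mult_le_weighted:
  fixes a b d :: real
  assumes "0 < d"
  shows "2 * (a * b) \<le> d * a\<^sup>2 + b\<^sup>2 / d"
proof -
  have "2 * ((sqrt d * a) * (b / sqrt d)) \<le> (sqrt d * a)\<^sup>2 + (b / sqrt d)\<^sup>2"
    using sum_squares_bound[of "sqrt d * a" "b / sqrt d"] by (simp only: mult.assoc)
  then show ?thesis
    using assms by (simp add: power_mult_distrib power_divide)
qed

lemma abs_inner_le_weighted:
  fixes p q :: "'a::real_inner"
  assumes "0 < d"
  shows "\<bar>p \<bullet> q\<bar> \<le> d * (norm p)\<^sup>2 + (norm q)\<^sup>2 / d"
proof -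
  have "\<bar>p \<bullet> q\<bar> \<le> norm p * norm q"
    by (rule Cauchy_Schwarz_ineq2)
  moreover have "0 \<le> norm p * norm q"
    by (rule mult_nonneg_nonneg[OF norm_ge_zero norm_ge_zero])
  ultimately show ?thesis
    using two_mult_le_weighted[OF assms, of "norm p" "norm q"] by linarith
qed

lemma integrable_inner_L2:
  fixes p q :: "'a \<Rightarrow> 'b::euclidean_space"
  assumes [measurable]: "p \<in> borel_measurable M" "q \<in> borel_measurable M" "a \<in> borel_measurable M"
    and "integrable M (\<lambda>x. (norm (p x))\<^sup>2)" "integrable M (\<lambda>x. (norm (q x))\<^sup>2)"
    and "\<And>x. \<bar>a x\<bar> \<le> C"
  shows "integrable M (\<lambda>x. a x * (p x \<bullet> q x))"
proof (rule Bochner_Integration.integrable_bound)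
  show "integrable M (\<lambda>x. C * ((norm (p x))\<^sup>2 + (norm (q x))\<^sup>2))"
    using assms by auto
  show "AE x in M. norm (a x * (p x \<bullet> q x)) \<le> norm (C * ((norm (p x))\<^sup>2 + (norm (q x))\<^sup>2))"
  proof (rule AE_I2)
    fix x
    have "\<bar>a x\<bar> * \<bar>p x \<bullet> q x\<bar> \<le> C * ((norm (p x))\<^sup>2 + (norm (q x))\<^sup>2)"
      using abs_inner_le_weighted[of 1 "p x" "q x"] assms(6)[of x] by (intro mult_mono) auto
    also have "\<dots> \<le> norm (C * ((norm (p x))\<^sup>2 + (norm (q x))\<^sup>2))"
      unfolding real_norm_def by (rule abs_ge_self)
    finally show "norm (a x * (p x \<bullet> q x)) \<le> norm (C * ((norm (p x))\<^sup>2 + (norm (q x))\<^sup>2))"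
      by (simp only: real_norm_def abs_mult)
  qed
qed measurable

lemma integrable_norm_diff_squared:
  fixes p q :: "'a \<Rightarrow> 'b::euclidean_space"
  assumes [measurable]: "p \<in> borel_measurable M" "q \<in> borel_measurable M"
    and "integrable M (\<lambda>x. (norm (p x))\<^sup>2)" "integrable M (\<lambda>x. (norm (q x))\<^sup>2)"
  shows "integrable M (\<lambda>x. (norm (p x - q x))\<^sup>2)"
proof (rule Bochner_Integration.integrable_bound)
  show "integrable M (\<lambda>x. 2 * (norm (p x))\<^sup>2 + 2 * (norm (q x))\<^sup>2)"
    using assms by auto
  show "AE x in M. norm ((norm (p x - q x))\<^sup>2) \<le> norm (2 * (norm (p x))\<^sup>2 + 2 * (norm (q x))\<^sup>2)"
  proof (rule AE_I2)
    fix x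
    have "(norm (p x - q x))\<^sup>2 + (norm (p x + q x))\<^sup>2 = 2 * (norm (p x))\<^sup>2 + 2 * (norm (q x))\<^sup>2"
      by (simp add: power2_norm_eq_inner inner_diff_left inner_diff_right inner_add_left inner_add_right)
    moreover have "0 \<le> (norm (p x + q x))\<^sup>2" by simp
    ultimately have "(norm (p x - q x))\<^sup>2 \<le> 2 * (norm (p x))\<^sup>2 + 2 * (norm (q x))\<^sup>2"
      by linarith
    also have "\<dots> \<le> norm (2 * (norm (p x))\<^sup>2 + 2 * (norm (q x))\<^sup>2)"
      unfolding real_norm_def by (rule abs_ge_self)
    finally show "norm ((norm (p x - q x))\<^sup>2) \<le> norm (2 * (norm (p x))\<^sup>2 + 2 * (norm (q x))\<^sup>2)"
      by simp
  qed
qed measurable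

text \<open>Splitting \<open>qn\<close> into \<open>qn - q\<close> and \<open>q\<close> separates
  two modes of convergence: the first part is small by L2 convergence, as the factors
  \<open>an\<close> are uniformly bounded; the second converges by domination.\<close>

lemma tendsto_integral_inner_L2:
  fixes p q :: "'a \<Rightarrow> 'b::euclidean_space" and qn :: "nat \<Rightarrow> 'a \<Rightarrow> 'b"
  assumes [measurable]: "p \<in> borel_measurable M" "q \<in> borel_measurable M"
      "\<And>n. qn n \<in> borel_measurable M" "\<And>n. an n \<in> borel_measurable M" "a \<in> borel_measurable M"
    and p: "integrable M (\<lambda>x. (norm (p x))\<^sup>2)" and q: "integrable M (\<lambda>x. (norm (q x))\<^sup>2)"
    and qn: "\<And>n. integrable M (\<lambda>x. (norm (qn n x))\<^sup>2)"
    and lim: "(\<lambda>n. LINT x|M. (norm (qn n x - q x))\<^sup>2) \<longlonglongrightarrow> 0"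
    and bound: "\<And>n x. \<bar>an n x\<bar> \<le> C"
    and ae: "AE x in M. (\<lambda>n. an n x) \<longlonglongrightarrow> a x"
  shows "(\<lambda>n. LINT x|M. an n x * (p x \<bullet> qn n x)) \<longlonglongrightarrow> (LINT x|M. a x * (p x \<bullet> q x))"
proof -
  have C: "0 \<le> C" using bound[of 0 undefined] by linarith
  define D where "D n = (LINT x|M. (norm (qn n x - q x))\<^sup>2)" for n
  \<comment> \<open>The weight for Young's inequality: both \<open>d n\<close> and
    \<open>D n / d n\<close> tend to zero. The second summand keeps it positive when
    \<open>D n = 0\<close>.\<close>
  define d where "d n = sqrt (D n) + 1 / real (Suc n)" for n
  let ?P = "LINT x|M. (norm (p x))\<^sup>2"
  have D0: "0 \<le> D n" for n by (simp add: D_def)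
  then have d0: "0 < d n" for n
    by (simp add: d_def add_nonneg_pos)
  have Dd: "D n / d n \<le> sqrt (D n)" for n
  proof -
    have "D n = sqrt (D n) * sqrt (D n)" using D0 by simp
    also have "\<dots> \<le> sqrt (D n) * d n"
      using D0[of n] by (intro mult_left_mono) (auto simp: d_def)
    finally show ?thesis using d0[of n] by (simp add: pos_divide_le_eq)
  qed
  have sq: "(\<lambda>n. sqrt (D n)) \<longlonglongrightarrow> 0"
    using tendsto_real_sqrt[OF lim] by (simp add: D_def)
  have dlim: "d \<longlonglongrightarrow> 0"
    unfolding d_def using tendsto_add[OF sq LIMSEQ_inverse_real_of_nat] by (simp add: inverse_eq_divide)
  have dint: "integrable M (\<lambda>x. (norm (qn n x - q x))\<^sup>2)" for n
    by (rule integrable_norm_diff_squared) (use q qn in auto)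
  have diffint: "integrable M (\<lambda>x. an n x * (p x \<bullet> (qn n x - q x)))" for n
    by (rule integrable_inner_L2) (use p dint bound in auto)
  have "(\<lambda>n. LINT x|M. an n x * (p x \<bullet> (qn n x - q x))) \<longlonglongrightarrow> 0"
  proof (rule Lim_null_comparison)
    show "\<forall>\<^sub>F n in sequentially. norm (LINT x|M. an n x * (p x \<bullet> (qn n x - q x))) \<le> C * (d n * ?P + sqrt (D n))"
    proof (rule always_eventually, rule allI)
      fix n
      have "norm (LINT x|M. an n x * (p x \<bullet> (qn n x - q x)))
          \<le> (LINT x|M. C * (d n * (norm (p x))\<^sup>2 + (norm (qn n x - q x))\<^sup>2 / d n))"
      proof (rule order_trans[OF integral_norm_bound integral_mono])
        show "integrable M (\<lambda>x. norm (an n x * (p x \<bullet> (qn n x - q x))))"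
          using diffint by (rule integrable_norm)
        show "integrable M (\<lambda>x. C * (d n * (norm (p x))\<^sup>2 + (norm (qn n x - q x))\<^sup>2 / d n))"
          using p dint by auto
        fix x
        show "norm (an n x * (p x \<bullet> (qn n x - q x))) \<le> C * (d n * (norm (p x))\<^sup>2 + (norm (qn n x - q x))\<^sup>2 / d n)"
          using mult_mono[OF bound[of n x] abs_inner_le_weighted[OF d0[of n], of "p x" "qn n x - q x"] C]
          by (simp add: abs_mult)
      qed
      also have "\<dots> = C * (d n * ?P + D n / d n)"
        using p dint[of n] by (simp add: D_def)
      also have "\<dots> \<le> C * (d n * ?P + sqrt (D n))"
        using C Dd[of n] by (intro mult_left_mono) auto
      finally show "norm (LINT x|M. an n x * (p x \<bullet> (qn n x - q x))) \<le> C * (d n * ?P + sqrt (D n))" .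
    qed
    show "(\<lambda>n. C * (d n * ?P + sqrt (D n))) \<longlonglongrightarrow> 0"
      using tendsto_mult_left[OF tendsto_add[OF tendsto_mult_right[OF dlim, of ?P] sq], of C]
      by (simp only: mult_zero_left add_0 mult_zero_right)
  qed
  moreover have "(\<lambda>n. LINT x|M. an n x * (p x \<bullet> q x)) \<longlonglongrightarrow> (LINT x|M. a x * (p x \<bullet> q x))"
  proof (rule integral_dominated_convergence[where w = "\<lambda>x. C * \<bar>p x \<bullet> q x\<bar>"])
    show "integrable M (\<lambda>x. C * \<bar>p x \<bullet> q x\<bar>)"
      using integrable_inner_L2[of p M q "\<lambda>_. 1" 1] p q by auto
    show "AE x in M. (\<lambda>n. an n x * (p x \<bullet> q x)) \<longlonglongrightarrow> a x * (p x \<bullet> q x)"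
      using ae by eventually_elim (auto intro: tendsto_mult)
    show "AE x in M. norm (an n x * (p x \<bullet> q x)) \<le> C * \<bar>p x \<bullet> q x\<bar>" for n
      using bound[of n] by (intro AE_I2) (simp add: abs_mult mult_right_mono)
  qed measurable
  moreover have "(LINT x|M. an n x * (p x \<bullet> qn n x))
      = (LINT x|M. an n x * (p x \<bullet> (qn n x - q x))) + (LINT x|M. an n x * (p x \<bullet> q x))" for n
  proof -
    have "integrable M (\<lambda>x. an n x * (p x \<bullet> q x))"
      by (rule integrable_inner_L2) (use p q bound in auto)
    then have "(LINT x|M. an n x * (p x \<bullet> (qn n x - q x)) + an n x * (p x \<bullet> q x))
        = (LINT x|M. an n x * (p x \<bullet> (qn n x - q x))) + (LINT x|M. an n x * (p x \<bullet> q x))"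
      by (rule Bochner_Integration.integral_add[OF diffint])
    moreover have "an n x * (p x \<bullet> (qn n x - q x)) + an n x * (p x \<bullet> q x) = an n x * (p x \<bullet> qn n x)" for x
      by (simp add: inner_diff_right right_diff_distrib)
    ultimately show ?thesis
      by simp
  qed
  ultimately show ?thesis
    using tendsto_add by fastforce
qed

text \<open>A nonempty open set is not negligible. For continuous solutions the exceptional set of a
  weak inequality is open, hence empty.\<close>

lemma AE_open_imp:
  fixes S :: "'a::euclidean_space set"
  assumes "AE x in lborel. x \<in> S \<longrightarrow> P x" and "open {x \<in> S. \<not> P x}" and "x \<in> S"
  shows "P x"
proof (rule ccontr)
  assume "\<not> P x"
  with assms(3) have ne: "{x \<in> S. \<not> P x} \<noteq> {}" by auto
  have "{x \<in> S. \<not> P x} \<in> null_sets lborel"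
  proof (rule iffD2[OF AE_iff_null_sets])
    show "{x \<in> S. \<not> P x} \<in> sets lborel"
      using assms(2) by simp
    show "AE x in lborel. x \<notin> {x \<in> S. \<not> P x}"
      using assms(1) by eventually_elim auto
  qed
  then have "negligible {x \<in> S. \<not> P x}"
    by (simp add: negligible_iff_null_sets null_sets_completionI)
  with assms(2) ne show False
    using open_not_negligible by blast
qed

section \<open>Comparison of a solution with its reflection\<close>

text \<open>Extension by zero moves the integrals to the whole space, where a reflection can act;
  test functions and their gradients already vanish outside \<open>U\<close>. A subsequence trades
  the L2 convergence of the functions for almost everywhere convergence, which survives composition
  with \<open>flat\<close> and \<open>lift\<close>. The gradients enter linearly and keep L2
  convergence.\<close>

lemma H10_approximation:
  fixes u :: "'a::euclidean_space \<Rightarrow> real"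
  assumes "U \<in> sets borel" and "u \<in> H10 U"
  obtains g and \<phi> :: "nat \<Rightarrow> 'a \<Rightarrow> real" where "has_weak_gradient U u g"
    and "\<And>n. \<phi> n \<in> test_functions U"
    and "(\<lambda>x. indicator U x * u x) \<in> borel_measurable borel"
    and "AE x in lborel. (\<lambda>n. \<phi> n x) \<longlonglongrightarrow> indicator U x * u x"
    and "(\<lambda>x. indicator U x *\<^sub>R g x) \<in> borel_measurable borel"
    and "integrable lborel (\<lambda>x. (norm (indicator U x *\<^sub>R g x))\<^sup>2)"
    and "(\<lambda>n. LINT x|lborel. (norm (grad (\<phi> n) x - indicator U x *\<^sub>R g x))\<^sup>2) \<longlonglongrightarrow> 0"
proof -
  from assms(2) obtain g and \<phi> :: "nat \<Rightarrow> 'a \<Rightarrow> real" where u: "L2_on U u"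
    and wg: "has_weak_gradient U u g" and g: "L2_on U g"
    and \<phi>: "\<And>n. \<phi> n \<in> test_functions U"
    and lim: "(\<lambda>n. LINT x:U|lborel. (\<phi> n x - u x)\<^sup>2) \<longlonglongrightarrow> 0"
    and glim: "(\<lambda>n. LINT x:U|lborel. (norm (grad (\<phi> n) x - g x))\<^sup>2) \<longlonglongrightarrow> 0"
    unfolding H10_def mem_Collect_eq by blast
  let ?u = "\<lambda>x. indicator U x * u x" and ?g = "\<lambda>x. indicator U x *\<^sub>R g x"
  have um: "?u \<in> borel_measurable borel" and gm: "?g \<in> borel_measurable borel"
    using u g by (simp_all add: L2_on_def set_borel_measurable_def)
  have u2: "integrable lborel (\<lambda>x. (norm (?u x))\<^sup>2)"
  proof -
    have "(norm (?u x))\<^sup>2 = indicator U x *\<^sub>R (norm (u x))\<^sup>2" for x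
      by (simp add: indicator_def)
    then show ?thesis
      using u by (simp add: L2_on_def set_integrable_def)
  qed
  have g2: "integrable lborel (\<lambda>x. (norm (?g x))\<^sup>2)"
  proof -
    have "(norm (?g x))\<^sup>2 = indicator U x *\<^sub>R (norm (g x))\<^sup>2" for x
      by (simp add: indicator_def)
    then show ?thesis
      using g by (simp add: L2_on_def set_integrable_def)
  qed
  have \<phi>m: "\<phi> n \<in> borel_measurable borel" for n
    using test_functions_continuous[OF \<phi>] by (rule borel_measurable_continuous_onI)
  have \<phi>2: "integrable lborel (\<lambda>x. (norm (\<phi> n x))\<^sup>2)" for n
  proof -
    obtain K where "compact K" "\<forall>x. x \<notin> K \<longrightarrow> \<phi> n x = 0"
      using test_functions_support[OF \<phi>] by metis
    then show ?thesis
      using test_functions_continuous[OF \<phi>]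
      by (intro continuous_compact_support_integrable[of _ K]) (auto intro!: continuous_intros)
  qed
  have eq: "indicator U x *\<^sub>R (\<phi> n x - u x)\<^sup>2 = (norm (\<phi> n x - ?u x))\<^sup>2" for n x
    using test_functions_outside[OF \<phi>] by (auto simp: indicator_def)
  have geq: "indicator U x *\<^sub>R (norm (grad (\<phi> n) x - g x))\<^sup>2 = (norm (grad (\<phi> n) x - ?g x))\<^sup>2" for n x
    using test_functions_outside[OF \<phi>] by (auto simp: indicator_def)
  have "\<exists>r::nat\<Rightarrow>nat. strict_mono r \<and> (AE x in lborel. (\<lambda>n. (norm (\<phi> (r n) x - ?u x))\<^sup>2) \<longlonglongrightarrow> 0)"
  proof (rule tendsto_L1_AE_subseq)
    show "integrable lborel (\<lambda>x. (norm (\<phi> n x - ?u x))\<^sup>2)" for n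
      by (rule integrable_norm_diff_squared) (use \<phi>m um \<phi>2 u2 in simp_all)
    show "(\<lambda>n. LINT x|lborel. norm ((norm (\<phi> n x - ?u x))\<^sup>2)) \<longlonglongrightarrow> 0"
    proof -
      have "norm ((norm (\<phi> n x - ?u x))\<^sup>2) = indicator U x *\<^sub>R (\<phi> n x - u x)\<^sup>2" for n x
        unfolding eq by simp
      with lim show ?thesis
        by (simp only: set_lebesgue_integral_def)
    qed
  qed
  then obtain r :: "nat \<Rightarrow> nat" where r: "strict_mono r"
    and ae: "AE x in lborel. (\<lambda>n. (norm (\<phi> (r n) x - ?u x))\<^sup>2) \<longlonglongrightarrow> 0"
    by blast
  show thesis
  proof (rule that[of g "\<lambda>n. \<phi> (r n)"])
    show "AE x in lborel. (\<lambda>n. \<phi> (r n) x) \<longlonglongrightarrow> ?u x"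
      using ae
    proof eventually_elim
      case (elim x)
      from tendsto_real_sqrt[OF elim] have "(\<lambda>n. norm (\<phi> (r n) x - ?u x)) \<longlonglongrightarrow> 0"
        by simp
      then show ?case
        by (rule LIM_zero_cancel[OF tendsto_norm_zero_cancel])
    qed
    show "(\<lambda>n. LINT x|lborel. (norm (grad (\<phi> (r n)) x - ?g x))\<^sup>2) \<longlonglongrightarrow> 0"
      using LIMSEQ_subseq_LIMSEQ[OF glim r] by (simp only: set_lebesgue_integral_def geq o_def)
  qed (fact wg \<phi> um gm g2)+
qed

lemma variational_solution_test:
  assumes "variational_solution U u" and "U \<in> sets borel" and "has_weak_gradient U u g"
    and "\<psi> \<in> test_functions U"
  shows "integrable lborel (\<lambda>x. indicator U x * exp (- u x) * \<psi> x)"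
    and "(LINT x|lborel. (indicator U x *\<^sub>R g x) \<bullet> grad \<psi> x)
      = (LINT x|lborel. indicator U x * exp (- u x) * \<psi> x)"
proof -
  have "set_integrable lborel U (\<lambda>x. exp (- u x) * \<psi> x)"
    and "(LINT x:U|lborel. g x \<bullet> grad \<psi> x) = (LINT x:U|lborel. exp (- u x) * \<psi> x)"
    using assms(1,3) test_functions_H10[OF assms(2,4)] has_weak_gradient_test_function[OF assms(4)]
    unfolding variational_solution_def by blast+
  then show "integrable lborel (\<lambda>x. indicator U x * exp (- u x) * \<psi> x)"
    and "(LINT x|lborel. (indicator U x *\<^sub>R g x) \<bullet> grad \<psi> x)
      = (LINT x|lborel. indicator U x * exp (- u x) * \<psi> x)"
    by (simp_all add: set_integrable_def set_lebesgue_integral_def mult.assoc)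
qed

section \<open>Limits and bounds for the test functions, and nonnegativity of solutions\<close>

lemma flat_0_has_derivative: "(flat 0 has_real_derivative flat 2 t) (at t)"
  using flat_has_derivative[of 0 t] by (simp add: numeral_2_eq_2)

lemma continuous_flat: "continuous_on UNIV (flat m)"
  using flat_has_derivative by (meson DERIV_isCont continuous_at_imp_continuous_on)

lemma tendsto_flat: "f \<longlonglongrightarrow> l \<Longrightarrow> (\<lambda>n. flat m (f n)) \<longlonglongrightarrow> flat m l"
  using continuous_on_tendsto_compose[OF continuous_flat] by fastforce

lemma measurable_flat [measurable]: "flat m \<in> borel_measurable borel"
  using continuous_flat by (rule borel_measurable_continuous_onI)

lemma continuous_lift:
  assumes "0 < e"
  shows "continuous_on UNIV (lift e)"
  using lift_has_derivative[OF assms] by (meson DERIV_isCont continuous_at_imp_continuous_on)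

lemma tendsto_lift: "0 < e \<Longrightarrow> f \<longlonglongrightarrow> l \<Longrightarrow> (\<lambda>n. lift e (f n)) \<longlonglongrightarrow> lift e l"
  using continuous_on_tendsto_compose[OF continuous_lift] by fastforce

lemma tendsto_lift':
  assumes "f \<longlonglongrightarrow> l"
  shows "(\<lambda>n. lift' e (f n)) \<longlonglongrightarrow> lift' e l"
proof -
  have "(\<lambda>n. - f n / e) \<longlonglongrightarrow> - l / e"
    using tendsto_mult_right[OF tendsto_minus[OF assms], of "inverse e"]
    by (simp add: divide_inverse)
  then show ?thesis
    unfolding lift'_def by (intro tendsto_diff tendsto_const tendsto_flat)
qed

lemma measurable_lift [measurable]: "lift e \<in> borel_measurable borel" "lift' e \<in> borel_measurable borel"
  unfolding lift_def[abs_def] lift'_def[abs_def] by measurable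

lemma abs_flat_2_le: "\<bar>flat 2 t\<bar> \<le> 2"
  using flat_nonneg[of 2 t] flat_2_le_2[of t] by simp

lemma abs_flat_0_le: "\<bar>flat 0 t\<bar> \<le> 1"
  using flat_nonneg[of 0 t] flat_0_le_1[of t] by simp

lemma integrable_grad_squared:
  assumes "\<phi> \<in> test_functions U"
  shows "integrable lborel (\<lambda>x. (norm (grad \<phi> x))\<^sup>2)"
proof -
  obtain K where "compact K" "\<forall>x. x \<notin> K \<longrightarrow> grad \<phi> x = 0"
    using test_functions_support[OF assms] by metis
  then show ?thesis
    using test_functions_continuous_grad[OF assms]
    by (intro continuous_compact_support_integrable[of _ K]) (auto intro!: continuous_intros)
qed

lemma test_functions_measurable:
  assumes "\<phi> \<in> test_functions U"
  shows "\<phi> \<in> borel_measurable borel" and "grad \<phi> \<in> borel_measurable borel"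
  by (rule borel_measurable_continuous_onI[OF test_functions_continuous[OF assms]],
      rule borel_measurable_continuous_onI[OF test_functions_continuous_grad[OF assms]])

lemma flat_neg_test_function:
  assumes "\<phi> \<in> test_functions U"
  shows "(\<lambda>x. flat 0 (- \<phi> x)) \<in> test_functions U"
    and "grad (\<lambda>x. flat 0 (- \<phi> x)) x = - (flat 2 (- \<phi> x) *\<^sub>R grad \<phi> x)"
proof -
  obtain K where "compact K" "K \<subseteq> U" "\<forall>x. x \<notin> K \<longrightarrow> \<phi> x = 0"
    using test_functions_support[OF assms] by metis
  moreover have "Ck k (\<lambda>x. flat 0 (- \<phi> x))" for k
    using Ck_flat[OF Ck_cmult[OF test_functions_Ck[OF assms, of k], of "- 1"], of 0] by simp
  ultimately show "(\<lambda>x. flat 0 (- \<phi> x)) \<in> test_functions U"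
    by (intro test_functionsI[of _ K]) (simp_all add: flat_eq_0)
  have "GDERIV (\<lambda>x. flat 0 (- \<phi> x)) x :> flat 2 (- \<phi> x) *\<^sub>R (- grad \<phi> x)"
    by (rule GDERIV_DERIV_compose[OF GDERIV_minus[OF test_functions_GDERIV[OF assms]] flat_0_has_derivative])
  from grad_eqI[OF this] show "grad (\<lambda>x. flat 0 (- \<phi> x)) x = - (flat 2 (- \<phi> x) *\<^sub>R grad \<phi> x)"
    by simp
qed

text \<open>Testing with \<open>flat 0 (- u)\<close>, a smooth substitute for the negative part of \<open>u\<close>. The weight
  \<open>exp (- u)\<close> is cut off at \<open>1\<close> so that dominated convergence applies before \<open>u \<ge> 0\<close> is known.\<close>

lemma variational_solution_nonneg:
  fixes u :: "'a::euclidean_space \<Rightarrow> real"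
  assumes sol: "variational_solution U u" and U: "open U" "bounded U" and cont: "continuous_on U u"
    and x: "x \<in> U"
  shows "0 \<le> u x"
proof -
  have Ub [measurable]: "U \<in> sets borel" using U(1) by simp
  have Ufin: "emeasure lborel U < \<infinity>"
    using U(2) by (rule emeasure_bounded_finite)
  from sol have "u \<in> H10 U" by (simp add: variational_solution_def)
  from H10_approximation[OF Ub this] obtain g and \<phi> :: "nat \<Rightarrow> 'a \<Rightarrow> real"
    where wg: "has_weak_gradient U u g"
    and \<phi>: "\<And>n. \<phi> n \<in> test_functions U"
    and um [measurable]: "(\<lambda>x. indicator U x * u x) \<in> borel_measurable borel"
    and ae: "AE x in lborel. (\<lambda>n. \<phi> n x) \<longlonglongrightarrow> indicator U x * u x"
    and gm [measurable]: "(\<lambda>x. indicator U x *\<^sub>R g x) \<in> borel_measurable borel"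
    and g2: "integrable lborel (\<lambda>x. (norm (indicator U x *\<^sub>R g x))\<^sup>2)"
    and glim: "(\<lambda>n. LINT x|lborel. (norm (grad (\<phi> n) x - indicator U x *\<^sub>R g x))\<^sup>2) \<longlonglongrightarrow> 0"
    by blast
  define u' where "u' x = indicator U x * u x" for x
  define g' where "g' x = indicator U x *\<^sub>R g x" for x
  define k where "k x = indicator U x * min 1 (exp (- u' x))" for x
  note [measurable] = um[folded u'_def] gm[folded g'_def] test_functions_measurable[OF \<phi>]
  have [measurable]: "k \<in> borel_measurable borel"
    unfolding k_def[abs_def] by measurable
  have kle: "0 \<le> k x" "k x \<le> indicator U x * exp (- u x)" "\<bar>k x\<bar> \<le> indicator U x" for x
    by (auto simp: k_def u'_def indicator_def)
  let ?V = "\<lambda>n x. flat 0 (- \<phi> n x)"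
  have "(\<lambda>n. LINT x|lborel. flat 2 (- \<phi> n x) * (g' x \<bullet> grad (\<phi> n) x))
      \<longlonglongrightarrow> (LINT x|lborel. flat 2 (- u' x) * (g' x \<bullet> g' x))"
  proof (rule tendsto_integral_inner_L2[where C = 2])
    show "AE x in lborel. (\<lambda>n. flat 2 (- \<phi> n x)) \<longlonglongrightarrow> flat 2 (- u' x)"
      using ae unfolding u'_def by eventually_elim (intro tendsto_flat tendsto_minus)
  qed (use g2 glim integrable_grad_squared[OF \<phi>] abs_flat_2_le in \<open>simp_all add: g'_def[symmetric]\<close>)
  \<comment> \<open>The equation rewrites the source integral as a gradient integral. Its
    convergence thus comes from \<open>H10\<close>, although \<open>exp (- u)\<close> is not yet
    known to be bounded.\<close>
  moreover have "(LINT x|lborel. indicator U x * exp (- u x) * ?V n x)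
      = - (LINT x|lborel. flat 2 (- \<phi> n x) * (g' x \<bullet> grad (\<phi> n) x))" for n
    using variational_solution_test(2)[OF sol Ub wg flat_neg_test_function(1)[OF \<phi>[of n]]]
    by (simp add: flat_neg_test_function(2)[OF \<phi>] g'_def[symmetric])
  ultimately have lim1: "(\<lambda>n. LINT x|lborel. indicator U x * exp (- u x) * ?V n x)
      \<longlonglongrightarrow> - (LINT x|lborel. flat 2 (- u' x) * (g' x \<bullet> g' x))"
    by (simp add: tendsto_minus)
  have Vint: "integrable lborel (\<lambda>x. k x * flat 0 (f x))" if [measurable]: "f \<in> borel_measurable borel" for f
  proof (rule Bochner_Integration.integrable_bound)
    show "integrable lborel (indicator U :: 'a \<Rightarrow> real)"
      using Ufin by simp
    show "AE x in lborel. norm (k x * flat 0 (f x)) \<le> norm (indicator U x :: real)"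
      using mult_mono[OF kle(3) abs_flat_0_le] by (intro AE_I2) (simp add: abs_mult)
  qed measurable
  have lim2: "(\<lambda>n. LINT x|lborel. k x * ?V n x) \<longlonglongrightarrow> (LINT x|lborel. k x * flat 0 (- u' x))"
  proof (rule integral_dominated_convergence[where w = "indicator U :: 'a \<Rightarrow> real"])
    show "integrable lborel (indicator U :: 'a \<Rightarrow> real)"
      using Ufin by simp
    show "AE x in lborel. norm (k x * ?V n x) \<le> indicator U x" for n
      using mult_mono[OF kle(3) abs_flat_0_le] by (intro AE_I2) (simp add: abs_mult)
    show "AE x in lborel. (\<lambda>n. k x * ?V n x) \<longlonglongrightarrow> k x * flat 0 (- u' x)"
      using ae unfolding u'_def by eventually_elim (intro tendsto_flat tendsto_minus tendsto_mult_left)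
  qed measurable
  have "(LINT x|lborel. k x * ?V n x) \<le> (LINT x|lborel. indicator U x * exp (- u x) * ?V n x)" for n
    by (rule integral_mono[OF Vint variational_solution_test(1)[OF sol Ub wg flat_neg_test_function(1)[OF \<phi>]]])
      (auto intro!: mult_right_mono kle flat_nonneg)
  \<comment> \<open>The left side is nonnegative and the right side nonpositive, so the left side
    vanishes. As \<open>k\<close> is positive on \<open>U\<close>, \<open>flat 0 (- u)\<close> is
    zero almost everywhere there.\<close>
  with lim1 lim2 have "(LINT x|lborel. k x * flat 0 (- u' x))
      \<le> - (LINT x|lborel. flat 2 (- u' x) * (g' x \<bullet> g' x))"
    by (intro LIMSEQ_le[OF lim2 lim1]) auto
  moreover have "0 \<le> (LINT x|lborel. flat 2 (- u' x) * (g' x \<bullet> g' x))"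
    by (intro Bochner_Integration.integral_nonneg mult_nonneg_nonneg flat_nonneg inner_ge_zero)
  moreover have "0 \<le> (LINT x|lborel. k x * flat 0 (- u' x))"
    by (intro Bochner_Integration.integral_nonneg mult_nonneg_nonneg flat_nonneg kle(1))
  ultimately have "(LINT x|lborel. k x * flat 0 (- u' x)) = 0"
    by linarith
  then have "AE x in lborel. k x * flat 0 (- u' x) = 0"
    using integral_nonneg_eq_0_iff_AE[OF Vint[of "\<lambda>x. - u' x"]] kle(1) flat_nonneg by simp
  then have "AE x in lborel. x \<in> U \<longrightarrow> 0 \<le> u x"
  proof eventually_elim
    case (elim x)
    show ?case
    proof
      assume "x \<in> U"
      have "0 < min 1 (exp (- u' x))" by simp
      then have "0 < k x" "u' x = u x"
        using \<open>x \<in> U\<close> by (simp_all add: k_def u'_def)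
      with elim have "flat 0 (- u x) = 0"
        by simp
      then show "0 \<le> u x"
        using flat_pos[of "- u x" 0] by (cases "u x < 0") auto
    qed
  qed
  moreover have "open {x \<in> U. \<not> 0 \<le> u x}"
    using continuous_open_preimage[OF cont U(1) open_lessThan[of 0]]
    by (simp add: vimage_def Int_def not_le)
  ultimately show ?thesis
    using x by (rule AE_open_imp)
qed

lemma test_functions_mono: "\<phi> \<in> test_functions S \<Longrightarrow> S \<subseteq> U \<Longrightarrow> \<phi> \<in> test_functions U"
  by (auto simp: test_functions_def)

lemma test_functions_orthogonal_involution:
  fixes \<rho> :: "'a::euclidean_space \<Rightarrow> 'a"
  assumes "orthogonal_transformation \<rho>" and "\<And>x. \<rho> (\<rho> x) = x"
    and "\<phi> \<in> test_functions S" and "\<rho> ` S \<subseteq> U"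
  shows "(\<lambda>x. \<phi> (\<rho> x)) \<in> test_functions U"
    and "grad (\<lambda>x. \<phi> (\<rho> x)) x = \<rho> (grad \<phi> (\<rho> x))"
proof -
  obtain K where K: "compact K" "K \<subseteq> S" "\<forall>x. x \<notin> K \<longrightarrow> \<phi> x = 0"
    using test_functions_support[OF assms(3)] by metis
  show "(\<lambda>x. \<phi> (\<rho> x)) \<in> test_functions U"
  proof (rule test_functionsI)
    show "compact (\<rho> ` K)"
      using K(1) by (metis assms(1) compact_continuous_image linear_continuous_on
          linear_conv_bounded_linear orthogonal_transformation_linear)
    show "\<rho> ` K \<subseteq> U"
      using K(2) assms(4) by blast
    show "\<phi> (\<rho> x) = 0" if "x \<notin> \<rho> ` K" for x
      using that K(3) assms(2) by (metis imageI)
    show "Ck k (\<lambda>x. \<phi> (\<rho> x))" for k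
      by (rule Ck_orthogonal_involution[OF assms(1,2) test_functions_Ck[OF assms(3)]])
  qed
  show "grad (\<lambda>x. \<phi> (\<rho> x)) x = \<rho> (grad \<phi> (\<rho> x))"
    by (rule grad_eqI[OF GDERIV_orthogonal_involution[OF assms(1,2) test_functions_GDERIV[OF assms(3)]]])
qed

text \<open>Since \<open>lift e\<close> is positive and lies above the identity, \<open>\<phi> - lift e (\<phi> \<circ> \<rho>)\<close> is negative at
  the fixed points of \<open>\<rho>\<close> and outside of \<open>U\<close>. This keeps the support away from the boundary of \<open>S\<close>.\<close>

lemma reflection_test_function:
  fixes \<rho> :: "'a::euclidean_space \<Rightarrow> 'a"
  assumes \<rho>: "orthogonal_transformation \<rho>" "\<And>x. \<rho> (\<rho> x) = x"
    and S: "open S" "closure S \<inter> U \<subseteq> S \<union> {x. \<rho> x = x}"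
    and e: "0 < e" and \<phi>: "\<phi> \<in> test_functions U"
  defines "V \<equiv> \<lambda>x. indicator S x * flat 0 (\<phi> x - lift e (\<phi> (\<rho> x)))"
  shows "V \<in> test_functions S"
    and "grad V x = indicator S x *\<^sub>R flat 2 (\<phi> x - lift e (\<phi> (\<rho> x))) *\<^sub>R
      (grad \<phi> x - lift' e (\<phi> (\<rho> x)) *\<^sub>R \<rho> (grad \<phi> (\<rho> x)))"
proof -
  define \<psi> where "\<psi> x = \<phi> x - lift e (\<phi> (\<rho> x))" for x
  define C where "C = closure {x \<in> S. 0 < \<psi> x}"
  obtain K where K: "compact K" "K \<subseteq> U" "\<forall>x. x \<notin> K \<longrightarrow> \<phi> x = 0"
    using test_functions_support[OF \<phi>] by metis
  have Ck: "Ck k \<psi>" for k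
    unfolding \<psi>_def[abs_def]
    by (intro Ck_diff Ck_lift Ck_orthogonal_involution[OF \<rho>] test_functions_Ck[OF \<phi>])
  have C: "x \<in> closure S" "0 \<le> \<psi> x" if "x \<in> C" for x
  proof -
    show "x \<in> closure S"
      using that closure_mono[of "{x \<in> S. 0 < \<psi> x}" S] by (auto simp: C_def)
    have "closed {x. 0 \<le> \<psi> x}"
      using Ck_continuous[OF Ck] by (intro closed_Collect_le) auto
    then have "C \<subseteq> {x. 0 \<le> \<psi> x}"
      unfolding C_def by (intro closure_minimal) auto
    with that show "0 \<le> \<psi> x" by auto
  qed
  have CK: "C \<subseteq> K"
  proof
    fix x assume "x \<in> C"
    then have "0 < \<phi> x"
      using C(2)[of x] lift_pos[OF e, of "\<phi> (\<rho> x)"] by (simp add: \<psi>_def)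
    with K(3) show "x \<in> K" by force
  qed
  \<comment> \<open>A point of \<open>C\<close> lies in \<open>K\<close>, hence in \<open>U\<close>,
    and in the closure of \<open>S\<close>. By \<open>S(2)\<close> it can miss \<open>S\<close> only
    by being a fixed point, where \<open>\<psi> x = \<phi> x - lift e (\<phi> x)\<close> is
    negative.\<close>
  have CS: "C \<subseteq> S"
  proof
    fix x assume x: "x \<in> C"
    have "\<rho> x \<noteq> x"
      using C(2)[OF x] lift_gt[OF e, of "\<phi> x"] by (auto simp: \<psi>_def)
    with S(2) C(1)[OF x] CK K(2) x show "x \<in> S" by blast
  qed
  have closed: "closed C" by (simp add: C_def)
  have "compact C"
    using compact_Int_closed[OF K(1) closed] CK by (simp add: Int_absorb1)
  have zero: "flat 0 (\<psi> x) = 0" if "x \<in> S - C" for x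
  proof -
    have "\<not> 0 < \<psi> x"
    proof
      assume "0 < \<psi> x"
      with that have "x \<in> {x \<in> S. 0 < \<psi> x}" by simp
      then have "x \<in> C" unfolding C_def by (rule subsetD[OF closure_subset])
      with that show False by simp
    qed
    then show ?thesis by (intro flat_eq_0) simp
  qed
  have V: "V = (\<lambda>x. indicator S x * flat 0 (\<psi> x))"
    by (simp add: V_def \<psi>_def)
  show "V \<in> test_functions S"
    unfolding V
  proof (rule test_functionsI[OF _ \<open>compact C\<close> CS])
    show "Ck k (\<lambda>x. indicator S x * flat 0 (\<psi> x))" for k
      by (rule Ck_indicator[OF S(1) closed CS zero Ck_flat[OF Ck]])
    show "indicator S x * flat 0 (\<psi> x) = 0" if "x \<notin> C" for x
      using zero[of x] that by (cases "x \<in> S") auto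
  qed
  have "GDERIV \<psi> x :> grad \<phi> x - lift' e (\<phi> (\<rho> x)) *\<^sub>R \<rho> (grad \<phi> (\<rho> x))"
    unfolding \<psi>_def[abs_def]
    by (intro GDERIV_diff test_functions_GDERIV[OF \<phi>]
        GDERIV_DERIV_compose[OF GDERIV_orthogonal_involution[OF \<rho>] lift_has_derivative[OF e]])
  note grad = grad_eqI[OF GDERIV_indicator[OF S(1) closed CS zero
        GDERIV_DERIV_compose[OF this flat_0_has_derivative]]]
  show "grad V x = indicator S x *\<^sub>R flat 2 (\<phi> x - lift e (\<phi> (\<rho> x))) *\<^sub>R
      (grad \<phi> x - lift' e (\<phi> (\<rho> x)) *\<^sub>R \<rho> (grad \<phi> (\<rho> x)))"
    using grad unfolding V \<psi>_def by simp
qed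

section \<open>Measure-preserving changes of variables and the comparison\<close>

lemma measure_preserving_integral:
  fixes f :: "'a::euclidean_space \<Rightarrow> real"
  assumes "distr lborel borel \<rho> = lborel" and "\<rho> \<in> borel_measurable borel"
    and "f \<in> borel_measurable borel"
  shows "(LINT x|lborel. f (\<rho> x)) = (LINT x|lborel. f x)"
  using integral_distr[of \<rho> lborel borel f] assms by simp

lemma measure_preserving_integrable:
  fixes f :: "'a::euclidean_space \<Rightarrow> real"
  assumes "distr lborel borel \<rho> = lborel" and "\<rho> \<in> borel_measurable borel"
    and "integrable lborel f"
  shows "integrable lborel (\<lambda>x. f (\<rho> x))"
  using integrable_distr_eq[of \<rho> lborel borel f] assms by (simp add: borel_measurable_integrable)

lemma measure_preserving_AE:
  fixes \<rho> :: "'a::euclidean_space \<Rightarrow> 'a"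
  assumes "distr lborel borel \<rho> = lborel" and "\<rho> \<in> borel_measurable borel"
    and "AE x in lborel. P x"
  shows "AE x in lborel. P (\<rho> x)"
proof -
  have "AE x in distr lborel borel \<rho>. P x"
    unfolding assms(1) by (rule assms(3))
  then show ?thesis
    using assms(2) by (intro AE_distrD[of \<rho> lborel borel]) auto
qed

text \<open>The limits are taken with \<open>\<phi> n\<close> approximating \<open>u\<close>. The gradient terms then combine to
  \<open>\<integral>\<^sub>S flat 2 w |\<nabla>w|\<^sup>2\<close> for \<open>w = u - u \<circ> \<rho> - e\<close>, because \<open>lift' e\<close> is \<open>1\<close> on the range of \<open>u\<close>.\<close>

lemma reflection_comparison_approx:
  fixes \<rho> :: "'a::euclidean_space \<Rightarrow> 'a"
  assumes sol: "variational_solution U u" and U: "open U" "bounded U" and cont: "continuous_on U u"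
    and \<rho>: "orthogonal_transformation \<rho>" "\<And>x. \<rho> (\<rho> x) = x" "distr lborel borel \<rho> = lborel"
    and S: "open S" "S \<subseteq> U" "\<rho> ` S \<subseteq> U" "closure S \<inter> U \<subseteq> S \<union> {x. \<rho> x = x}"
    and e: "0 < e" and x: "x \<in> S"
  shows "u x \<le> u (\<rho> x) + e"
proof -
  have Ub [measurable]: "U \<in> sets borel" and Sb [measurable]: "S \<in> sets borel"
    using U(1) S(1) by simp_all
  have Sint: "integrable lborel (\<lambda>x. 2 * indicator S x :: real)"
    using emeasure_bounded_finite[OF bounded_subset[OF U(2) S(2)]] by simp
  have \<rho>cont: "continuous_on A \<rho>" for A
    using \<rho>(1) by (metis linear_continuous_on linear_conv_bounded_linear orthogonal_transformation_linear)
  have \<rho>m [measurable]: "\<rho> \<in> borel_measurable borel"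
    using \<rho>cont by (rule borel_measurable_continuous_onI)
  have \<rho>norm: "norm (\<rho> y) = norm y" for y
    using \<rho>(1) by (simp add: orthogonal_transformation_norm)
  have \<rho>diff: "\<rho> (y - z) = \<rho> y - \<rho> z" for y z
    using \<rho>(1) by (simp add: linear_diff orthogonal_transformation_linear)
  have nonneg: "0 \<le> u y" if "y \<in> U" for y
    by (rule variational_solution_nonneg[OF sol U cont that])
  from sol have "u \<in> H10 U" by (simp add: variational_solution_def)
  from H10_approximation[OF Ub this] obtain g and \<phi> :: "nat \<Rightarrow> 'a \<Rightarrow> real"
    where wg: "has_weak_gradient U u g"
    and \<phi>: "\<And>n. \<phi> n \<in> test_functions U"
    and um: "(\<lambda>x. indicator U x * u x) \<in> borel_measurable borel"
    and ae: "AE x in lborel. (\<lambda>n. \<phi> n x) \<longlonglongrightarrow> indicator U x * u x"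
    and gm: "(\<lambda>x. indicator U x *\<^sub>R g x) \<in> borel_measurable borel"
    and g2: "integrable lborel (\<lambda>x. (norm (indicator U x *\<^sub>R g x))\<^sup>2)"
    and glim: "(\<lambda>n. LINT x|lborel. (norm (grad (\<phi> n) x - indicator U x *\<^sub>R g x))\<^sup>2) \<longlonglongrightarrow> 0"
    by blast
  define u' where "u' x = indicator U x * u x" for x
  define g' where "g' x = indicator U x *\<^sub>R g x" for x
  define E where "E x = indicator U x * exp (- u x)" for x
  define w where "w x = u' x - lift e (u' (\<rho> x))" for x
  define \<psi> where "\<psi> n x = \<phi> n x - lift e (\<phi> n (\<rho> x))" for n x
  define p where "p x = g' x - \<rho> (g' (\<rho> x))" for x
  define V where "V n x = indicator S x * flat 0 (\<psi> n x)" for n x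
  have u'm [measurable]: "u' \<in> borel_measurable borel"
    using um by (simp add: u'_def[abs_def])
  have g'm [measurable]: "g' \<in> borel_measurable borel"
    using gm by (simp add: g'_def[abs_def])
  have \<phi>m [measurable]: "\<phi> n \<in> borel_measurable borel" "grad (\<phi> n) \<in> borel_measurable borel" for n
    using test_functions_measurable[OF \<phi>] by auto
  \<comment> \<open>Measurability is known for the extension \<open>u'\<close>, so \<open>E\<close>
    is expressed through it.\<close>
  have "E = (\<lambda>x. indicator U x * exp (- u' x))"
    by (auto simp: E_def u'_def indicator_def fun_eq_iff)
  then have Em [measurable]: "E \<in> borel_measurable borel"
    by simp
  have [measurable]: "w \<in> borel_measurable borel" "\<psi> n \<in> borel_measurable borel"
      "p \<in> borel_measurable borel" "V n \<in> borel_measurable borel" for n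
    unfolding w_def[abs_def] \<psi>_def[abs_def] p_def[abs_def] V_def[abs_def] by measurable
  have g'2: "integrable lborel (\<lambda>x. (norm (g' x))\<^sup>2)"
    using g2 by (simp add: g'_def)
  have g'lim: "(\<lambda>n. LINT x|lborel. (norm (grad (\<phi> n) x - g' x))\<^sup>2) \<longlonglongrightarrow> 0"
    using glim by (simp only: g'_def)
  have \<rho>g'2: "integrable lborel (\<lambda>x. (norm (\<rho> (g' (\<rho> x))))\<^sup>2)"
    using measure_preserving_integrable[OF \<rho>(3) \<rho>m g'2] by (simp add: \<rho>norm)
  have p2: "integrable lborel (\<lambda>x. (norm (p x))\<^sup>2)"
    unfolding p_def by (rule integrable_norm_diff_squared) (use g'2 \<rho>g'2 in simp_all)
  have \<phi>2: "integrable lborel (\<lambda>x. (norm (\<rho> (grad (\<phi> n) (\<rho> x))))\<^sup>2)" for n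
    using measure_preserving_integrable[OF \<rho>(3) \<rho>m integrable_grad_squared[OF \<phi>[of n]]]
    by (simp add: \<rho>norm)
  have \<rho>lim: "(\<lambda>n. LINT x|lborel. (norm (\<rho> (grad (\<phi> n) (\<rho> x)) - \<rho> (g' (\<rho> x))))\<^sup>2) \<longlonglongrightarrow> 0"
  proof -
    have "(LINT x|lborel. (norm (\<rho> (grad (\<phi> n) (\<rho> x)) - \<rho> (g' (\<rho> x))))\<^sup>2)
        = (LINT x|lborel. (norm (grad (\<phi> n) x - g' x))\<^sup>2)" for n
      using measure_preserving_integral[OF \<rho>(3) \<rho>m, of "\<lambda>x. (norm (grad (\<phi> n) x - g' x))\<^sup>2"]
      by (simp add: \<rho>diff[symmetric] \<rho>norm)
    with g'lim show ?thesis by simp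
  qed
  have ae': "AE x in lborel. (\<lambda>n. \<phi> n x) \<longlonglongrightarrow> u' x \<and> (\<lambda>n. \<phi> n (\<rho> x)) \<longlonglongrightarrow> u' (\<rho> x)"
    using ae measure_preserving_AE[OF \<rho>(3) \<rho>m ae] unfolding u'_def by eventually_elim auto
  have \<psi>lim: "AE x in lborel. (\<lambda>n. \<psi> n x) \<longlonglongrightarrow> w x"
    using ae' unfolding \<psi>_def w_def
    by eventually_elim (intro tendsto_diff tendsto_lift e; simp)
  have V: "V n = (\<lambda>x. indicator S x * flat 0 (\<phi> n x - lift e (\<phi> n (\<rho> x))))" for n
    by (simp add: V_def \<psi>_def fun_eq_iff)
  have Vtest: "V n \<in> test_functions S"
    "grad (V n) x = indicator S x *\<^sub>R flat 2 (\<psi> n x) *\<^sub>R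
      (grad (\<phi> n) x - lift' e (\<phi> n (\<rho> x)) *\<^sub>R \<rho> (grad (\<phi> n) (\<rho> x)))" for n x
    unfolding V \<psi>_def by (rule reflection_test_function[OF \<rho>(1,2) S(1,4) e \<phi>])+
  have VU: "V n \<in> test_functions U" for n
    by (rule test_functions_mono[OF Vtest(1) S(2)])
  have V\<rho>: "(\<lambda>x. V n (\<rho> x)) \<in> test_functions U"
    "grad (\<lambda>x. V n (\<rho> x)) x = \<rho> (grad (V n) (\<rho> x))" for n x
    using test_functions_orthogonal_involution[OF \<rho>(1,2) Vtest(1) S(3)] by auto
  note [measurable] = test_functions_measurable[OF VU]
  \<comment> \<open>The equation for \<open>u\<close> is tested with both \<open>V n\<close> and
    \<open>V n \<circ> \<rho>\<close>. In the second instance a change of variables moves the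
    reflection from the test function to the gradient and the source; subtraction gives the weak
    equation for \<open>u - u \<circ> \<rho>\<close> against \<open>V n\<close>.\<close>
  have eq: "(LINT x|lborel. p x \<bullet> grad (V n) x) = (LINT x|lborel. (E x - E (\<rho> x)) * V n x)" for n
  proof -
    have "integrable lborel (\<lambda>x. E x * V n x)"
      using variational_solution_test(1)[OF sol Ub wg VU] by (simp add: E_def)
    moreover have "integrable lborel (\<lambda>x. E x * V n (\<rho> x))"
      using variational_solution_test(1)[OF sol Ub wg V\<rho>(1)] by (simp add: E_def)
    from measure_preserving_integrable[OF \<rho>(3) \<rho>m this]
    have "integrable lborel (\<lambda>x. E (\<rho> x) * V n x)"
      by (simp add: \<rho>(2))
    ultimately have 1: "(LINT x|lborel. (E x - E (\<rho> x)) * V n x)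
        = (LINT x|lborel. E x * V n x) - (LINT x|lborel. E (\<rho> x) * V n x)"
      by (simp add: left_diff_distrib)
    have "integrable lborel (\<lambda>x. 1 * (g' x \<bullet> grad (V n) x))"
      "integrable lborel (\<lambda>x. 1 * (\<rho> (g' (\<rho> x)) \<bullet> grad (V n) x))"
      by (rule integrable_inner_L2[where C = 1];
          use g'2 \<rho>g'2 integrable_grad_squared[OF VU] in simp)+
    then have 2: "(LINT x|lborel. p x \<bullet> grad (V n) x)
        = (LINT x|lborel. g' x \<bullet> grad (V n) x) - (LINT x|lborel. \<rho> (g' (\<rho> x)) \<bullet> grad (V n) x)"
      by (simp add: p_def inner_diff_left)
    have 3: "(LINT x|lborel. g' x \<bullet> grad (V n) x) = (LINT x|lborel. E x * V n x)"
      using variational_solution_test(2)[OF sol Ub wg VU] by (simp add: E_def g'_def)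
    have "(LINT x|lborel. \<rho> (g' (\<rho> x)) \<bullet> grad (V n) x)
        = (LINT x|lborel. \<rho> (g' (\<rho> (\<rho> x))) \<bullet> grad (V n) (\<rho> x))"
      by (rule measure_preserving_integral[OF \<rho>(3) \<rho>m, symmetric]) measurable
    also have "\<dots> = (LINT x|lborel. g' x \<bullet> grad (\<lambda>x. V n (\<rho> x)) x)"
      by (simp only: V\<rho>(2) \<rho>(2) orthogonal_involution_adjoint[OF \<rho>(1,2)])
    also have "\<dots> = (LINT x|lborel. E x * V n (\<rho> x))"
      using variational_solution_test(2)[OF sol Ub wg V\<rho>(1)] by (simp add: E_def g'_def)
    also have "\<dots> = (LINT x|lborel. E (\<rho> x) * V n (\<rho> (\<rho> x)))"
      by (rule measure_preserving_integral[OF \<rho>(3) \<rho>m, symmetric]) (use test_functions_measurable(1)[OF V\<rho>(1)] in measurable)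
    finally show ?thesis
      using 1 2 3 by (simp only: \<rho>(2))
  qed
  let ?a = "\<lambda>n x. indicator S x * flat 2 (\<psi> n x)"
  have ale: "\<bar>?a n x\<bar> \<le> 2" for n x
    using abs_flat_2_le by (simp add: indicator_def)
  have alim: "AE x in lborel. (\<lambda>n. ?a n x) \<longlonglongrightarrow> indicator S x * flat 2 (w x)"
    using \<psi>lim by eventually_elim (intro tendsto_mult_left tendsto_flat)
  have lim1: "(\<lambda>n. LINT x|lborel. ?a n x * (p x \<bullet> grad (\<phi> n) x))
      \<longlonglongrightarrow> (LINT x|lborel. indicator S x * flat 2 (w x) * (p x \<bullet> g' x))"
    by (rule tendsto_integral_inner_L2[OF _ _ _ _ _ p2 g'2 integrable_grad_squared[OF \<phi>] g'lim ale alim])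
      measurable
  let ?b = "\<lambda>n x. ?a n x * lift' e (\<phi> n (\<rho> x))"
  \<comment> \<open>The product of the bounds 2 for \<open>flat 2\<close> and 3 for
    \<open>lift'\<close>.\<close>
  have ble: "\<bar>?b n x\<bar> \<le> 6" for n x
    using mult_mono[OF ale[of x n] abs_lift'_le[of e "\<phi> n (\<rho> x)"]] unfolding abs_mult by simp
  have blim: "AE x in lborel. (\<lambda>n. ?b n x) \<longlonglongrightarrow> indicator S x * flat 2 (w x) * lift' e (u' (\<rho> x))"
    using alim ae' by eventually_elim (rule tendsto_mult[OF _ tendsto_lift'[OF conjunct2]])
  have lim2: "(\<lambda>n. LINT x|lborel. ?b n x * (p x \<bullet> \<rho> (grad (\<phi> n) (\<rho> x))))
      \<longlonglongrightarrow> (LINT x|lborel. indicator S x * flat 2 (w x) * lift' e (u' (\<rho> x)) * (p x \<bullet> \<rho> (g' (\<rho> x))))"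
    by (rule tendsto_integral_inner_L2[OF _ _ _ _ _ p2 \<rho>g'2 \<phi>2 \<rho>lim ble blim]) measurable
  have split: "(LINT x|lborel. p x \<bullet> grad (V n) x) = (LINT x|lborel. ?a n x * (p x \<bullet> grad (\<phi> n) x))
      - (LINT x|lborel. ?b n x * (p x \<bullet> \<rho> (grad (\<phi> n) (\<rho> x))))" for n
  proof -
    have "integrable lborel (\<lambda>x. ?a n x * (p x \<bullet> grad (\<phi> n) x))"
      by (rule integrable_inner_L2[OF _ _ _ p2 integrable_grad_squared[OF \<phi>] ale]) measurable
    moreover have "integrable lborel (\<lambda>x. ?b n x * (p x \<bullet> \<rho> (grad (\<phi> n) (\<rho> x))))"
      by (rule integrable_inner_L2[OF _ _ _ p2 \<phi>2 ble]) measurable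
    moreover have "p x \<bullet> grad (V n) x = ?a n x * (p x \<bullet> grad (\<phi> n) x)
        - ?b n x * (p x \<bullet> \<rho> (grad (\<phi> n) (\<rho> x)))" for x
      unfolding Vtest(2) inner_scaleR_right inner_diff_right by (simp add: right_diff_distrib mult.assoc)
    ultimately show ?thesis by simp
  qed
  have lhs: "(\<lambda>n. LINT x|lborel. p x \<bullet> grad (V n) x) \<longlonglongrightarrow>
      (LINT x|lborel. indicator S x * flat 2 (w x) * (p x \<bullet> p x))"
  proof -
    have on_S: "indicator S x * flat 2 (w x) * lift' e (u' (\<rho> x)) = indicator S x * flat 2 (w x)" for x
    proof (cases "x \<in> S")
      case True
      with S(3) have "\<rho> x \<in> U" by auto
      then have "0 \<le> u' (\<rho> x)" using nonneg by (simp add: u'_def)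
      then show ?thesis using lift'_nonneg_arg[OF e] by simp
    qed simp
    have c: "\<bar>indicator S x * flat 2 (w x)\<bar> \<le> 2" for x
      using abs_flat_2_le by (simp add: indicator_def)
    have "integrable lborel (\<lambda>x. indicator S x * flat 2 (w x) * (p x \<bullet> g' x))"
      by (rule integrable_inner_L2[OF _ _ _ p2 g'2 c]) measurable
    moreover have "integrable lborel (\<lambda>x. indicator S x * flat 2 (w x) * (p x \<bullet> \<rho> (g' (\<rho> x))))"
      by (rule integrable_inner_L2[OF _ _ _ p2 \<rho>g'2 c]) measurable
    ultimately have "(LINT x|lborel. indicator S x * flat 2 (w x) * (p x \<bullet> p x))
      = (LINT x|lborel. indicator S x * flat 2 (w x) * (p x \<bullet> g' x))
        - (LINT x|lborel. indicator S x * flat 2 (w x) * (p x \<bullet> \<rho> (g' (\<rho> x))))"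
      by (subst Bochner_Integration.integral_diff[symmetric])
        (simp_all add: p_def inner_diff_right right_diff_distrib)
    with tendsto_diff[OF lim1 lim2] show ?thesis
      by (simp only: on_S split)
  qed
  \<comment> \<open>Nonnegativity of \<open>u\<close> puts \<open>E\<close> between 0 and 1;
    boundedness of \<open>S\<close> then makes \<open>2 * indicator S x\<close> an integrable
    majorant.\<close>
  have Ediff: "\<bar>E x - E (\<rho> x)\<bar> \<le> 2" for x
  proof -
    have "0 \<le> E y \<and> E y \<le> 1" for y
      using nonneg[of y] by (auto simp: E_def indicator_def)
    from this[of x] this[of "\<rho> x"] show ?thesis by linarith
  qed
  have rhsbound: "norm ((E x - E (\<rho> x)) * (indicator S x * flat 0 t)) \<le> 2 * indicator S x" for x t
    using mult_mono[OF Ediff[of x] abs_flat_0_le[of t]] by (auto simp: abs_mult indicator_def)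
  let ?h = "\<lambda>x. (E x - E (\<rho> x)) * (indicator S x * flat 0 (w x))"
  have rhs: "(\<lambda>n. LINT x|lborel. (E x - E (\<rho> x)) * V n x) \<longlonglongrightarrow> (LINT x|lborel. ?h x)"
  proof (rule integral_dominated_convergence[OF _ _ Sint])
    show "AE x in lborel. (\<lambda>n. (E x - E (\<rho> x)) * V n x) \<longlonglongrightarrow> ?h x"
      using \<psi>lim unfolding V_def by eventually_elim (intro tendsto_mult_left tendsto_flat)
    show "AE x in lborel. norm ((E x - E (\<rho> x)) * V n x) \<le> 2 * indicator S x" for n
      unfolding V_def by (intro AE_I2 rhsbound)
  qed measurable
  have hint: "integrable lborel ?h"
    by (rule Bochner_Integration.integrable_bound[OF Sint]) (measurable, use rhsbound in \<open>auto intro!: AE_I2\<close>)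
  have wS: "w y = u y - u (\<rho> y) - e" if "y \<in> S" for y
  proof -
    have "y \<in> U" "\<rho> y \<in> U" using that S(2,3) by auto
    then show ?thesis
      using nonneg[of "\<rho> y"] lift_nonneg_arg[OF e, of "u (\<rho> y)"] by (simp add: w_def u'_def)
  qed
  have neg: "?h y \<le> 0 \<and> (y \<in> S \<longrightarrow> 0 < w y \<longrightarrow> ?h y < 0)" for y
  proof (cases "y \<in> S \<and> 0 < w y")
    case True
    then have "y \<in> U" "\<rho> y \<in> U" using S(2,3) by auto
    moreover have "u (\<rho> y) < u y" using wS[of y] True e by simp
    ultimately have "E y - E (\<rho> y) < 0" by (simp add: E_def)
    with True flat_pos[of "w y" 0] show ?thesis
      by (simp add: mult_neg_pos less_imp_le)
  next
    case False
    then have z: "indicator S y * flat 0 (w y) = 0"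
      by (cases "y \<in> S") (simp_all add: flat_eq_0)
    show ?thesis unfolding z using False by auto
  qed
  \<comment> \<open>A nonnegative energy equals the integral of the nonpositive \<open>?h\<close>,
    so \<open>?h\<close> vanishes almost everywhere, which excludes \<open>0 < w\<close>
    there.\<close>
  have "0 \<le> (LINT x|lborel. indicator S x * flat 2 (w x) * (p x \<bullet> p x))"
    by (intro Bochner_Integration.integral_nonneg mult_nonneg_nonneg flat_nonneg inner_ge_zero) simp
  also have "\<dots> = (LINT x|lborel. ?h x)"
    using lhs rhs unfolding eq by (rule LIMSEQ_unique)
  finally have "(LINT x|lborel. - ?h x) \<le> 0" by simp
  moreover have "0 \<le> (LINT x|lborel. - ?h x)"
    using neg by (intro Bochner_Integration.integral_nonneg) simp
  ultimately have "(LINT x|lborel. - ?h x) = 0" by (rule order_antisym)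
  then have "AE x in lborel. - ?h x = 0"
    using neg by (subst (asm) integral_nonneg_eq_0_iff_AE) (auto intro: hint)
  then have "AE x in lborel. x \<in> S \<longrightarrow> \<not> 0 < w x"
  proof eventually_elim
    case (elim x)
    then have "?h x = 0" by (simp only: neg_equal_0_iff_equal)
    with neg[of x] show ?case by linarith
  qed
  then have "AE y in lborel. y \<in> S \<longrightarrow> \<not> 0 < u y - u (\<rho> y) - e"
    by eventually_elim (simp add: wS)
  moreover have "open {y \<in> S. \<not> \<not> 0 < u y - u (\<rho> y) - e}"
  proof -
    have "continuous_on S (\<lambda>y. u (\<rho> y))"
      by (rule continuous_on_compose2[OF cont \<rho>cont S(3)])
    then have "continuous_on S (\<lambda>y. u y - u (\<rho> y) - e)"
      by (intro continuous_on_diff continuous_on_const continuous_on_subset[OF cont S(2)])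
    from continuous_open_preimage[OF this S(1) open_greaterThan[of 0]] show ?thesis
      by (simp add: vimage_def Int_def)
  qed
  ultimately have "\<not> 0 < u x - u (\<rho> x) - e"
    using x by (rule AE_open_imp)
  then show ?thesis by linarith
qed

text \<open>The closure condition says that the boundary of \<open>S\<close> consists of mirror
  points, where the two sides agree, and points outside \<open>U\<close>, where \<open>u\<close> has
  zero boundary values while the reflected value is nonnegative. The margin \<open>e\<close> is
  arbitrary and drops out.\<close>

lemma reflection_comparison:
  fixes \<rho> :: "'a::euclidean_space \<Rightarrow> 'a"
  assumes "variational_solution U u" and "open U" "bounded U" and "continuous_on U u"
    and "orthogonal_transformation \<rho>" "\<And>x. \<rho> (\<rho> x) = x" "distr lborel borel \<rho> = lborel"
    and "open S" "S \<subseteq> U" "\<rho> ` S \<subseteq> U" "closure S \<inter> U \<subseteq> S \<union> {x. \<rho> x = x}" and "x \<in> S"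
  shows "u x \<le> u (\<rho> x)"
  by (rule field_le_epsilon, rule reflection_comparison_approx[OF assms(1-11) _ assms(12)])

section \<open>Reflections of sectors\<close>

text \<open>\<open>lborel\<close> is determined by its values on boxes. The preimage of a box is its
  image under the inverse, which is again orthogonal and preserves Lebesgue measure.\<close>

lemma distr_lborel_orthogonal:
  fixes f :: "real^'n::{finite,wellorder} \<Rightarrow> real^'n::_"
  assumes f: "orthogonal_transformation f"
  shows "distr lborel borel f = lborel"
proof (rule lborel_eqI[symmetric])
  have "continuous_on UNIV f"
    using f by (metis linear_continuous_on linear_conv_bounded_linear orthogonal_transformation_linear)
  then have fm [measurable]: "f \<in> borel_measurable borel"
    by (rule borel_measurable_continuous_onI)
  fix l u :: "(real, 'n) vec" assume le: "\<And>b. b \<in> Basis \<Longrightarrow> l \<bullet> b \<le> u \<bullet> b"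
  have vm: "f -` box l u \<in> sets borel"
    using measurable_sets[OF fm, of "box l u"] by simp
  have vi: "f -` box l u = inv f ` box l u"
    by (rule bij_vimage_eq_inv_image[OF orthogonal_transformation_bij[OF f]])
  have lm: "inv f ` box l u \<in> lmeasurable" "measure lebesgue (inv f ` box l u) = measure lebesgue (box l u)"
    using measurable_orthogonal_image[OF orthogonal_transformation_inv[OF f], of "box l u"]
      measure_orthogonal_image[OF orthogonal_transformation_inv[OF f], of "box l u"] by simp_all
  have "emeasure (distr lborel borel f) (box l u) = emeasure lborel (f -` box l u)"
    using emeasure_distr[of f lborel borel "box l u"] by simp
  also have "\<dots> = emeasure lebesgue (f -` box l u)"
    using vm by simp
  also have "\<dots> = emeasure lebesgue (box l u)"
    using lm unfolding vi by (simp only: emeasure_eq_measure2 lmeasurable_box)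
  also have "\<dots> = (\<Prod>b\<in>Basis. (u - l) \<bullet> b)"
    using le by (simp add: emeasure_lborel_box)
  finally show "emeasure (distr lborel borel f) (box l u) = (\<Prod>b\<in>Basis. (u - l) \<bullet> b)" .
qed simp

text \<open>The mirror is the line through the origin at angle \<open>\<alpha>\<close>, so
  \<open>\<alpha>\<close> is half of the angle that is exchanged with 0.\<close>

definition reflection :: "real \<Rightarrow> real^2 \<Rightarrow> real^2" where
  "reflection \<alpha> x = vector [cos (2 * \<alpha>) * x$1 + sin (2 * \<alpha>) * x$2, sin (2 * \<alpha>) * x$1 - cos (2 * \<alpha>) * x$2]"

lemma polar_nth [simp]: "polar r t $ 1 = r * cos t" "polar r t $ 2 = r * sin t"
  by (simp_all add: polar_def)

lemma norm_polar: "norm (polar r t) = \<bar>r\<bar>"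
proof -
  have "(norm (polar r t))\<^sup>2 = (r * cos t)\<^sup>2 + (r * sin t)\<^sup>2"
    unfolding power2_norm_eq_inner by (simp add: inner_vec_def sum_2 power2_eq_square)
  also have "\<dots> = \<bar>r\<bar>\<^sup>2"
    by (simp add: power_mult_distrib distrib_left[symmetric])
  finally show ?thesis by (rule power2_eq_imp_eq) simp_all
qed

lemma reflection_nth [simp]:
  "reflection \<alpha> x $ 1 = cos (2 * \<alpha>) * x$1 + sin (2 * \<alpha>) * x$2"
  "reflection \<alpha> x $ 2 = sin (2 * \<alpha>) * x$1 - cos (2 * \<alpha>) * x$2"
  by (simp_all add: reflection_def)

lemma reflection_polar: "reflection \<alpha> (polar r t) = polar r (2 * \<alpha> - t)"
  by (simp add: vec_eq_iff forall_2 cos_diff sin_diff algebra_simps)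

text \<open>The symmetric matrix with rows \<open>(c, s)\<close> and \<open>(s, - c)\<close> squares
  to the identity; the involution property and orthogonality both come down to this.\<close>

lemma rotation_square_sum:
  fixes c s a b :: real
  assumes "c\<^sup>2 + s\<^sup>2 = 1"
  shows "c * (c * a + s * b) + s * (s * a - c * b) = a" "s * (c * a + s * b) - c * (s * a - c * b) = b"
proof -
  have "c * (c * a + s * b) + s * (s * a - c * b) = (c\<^sup>2 + s\<^sup>2) * a"
    by (simp add: power2_eq_square algebra_simps)
  with assms show "c * (c * a + s * b) + s * (s * a - c * b) = a" by simp
  have "s * (c * a + s * b) - c * (s * a - c * b) = (c\<^sup>2 + s\<^sup>2) * b"
    by (simp add: power2_eq_square algebra_simps)
  with assms show "s * (c * a + s * b) - c * (s * a - c * b) = b" by simp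
qed

lemma reflection_involution: "reflection \<alpha> (reflection \<alpha> x) = x"
  by (simp add: vec_eq_iff forall_2 rotation_square_sum)

lemma orthogonal_reflection: "orthogonal_transformation (reflection \<alpha>)"
  unfolding orthogonal_transformation_def
proof (intro conjI allI)
  show lin: "linear (reflection \<alpha>)"
    by (rule linearI) (simp_all add: vec_eq_iff forall_2 algebra_simps)
  fix v w :: "real^2"
  let ?c = "cos (2 * \<alpha>)" and ?s = "sin (2 * \<alpha>)"
  have "reflection \<alpha> v \<bullet> reflection \<alpha> w
      = v$1 * (?c * (?c * w$1 + ?s * w$2) + ?s * (?s * w$1 - ?c * w$2))
        + v$2 * (?s * (?c * w$1 + ?s * w$2) - ?c * (?s * w$1 - ?c * w$2))"
    by (simp add: inner_vec_def sum_2 algebra_simps)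
  also have "\<dots> = v \<bullet> w"
    by (simp only: rotation_square_sum[OF sin_cos_squared_add2]) (simp add: inner_vec_def sum_2)
  finally show "reflection \<alpha> v \<bullet> reflection \<alpha> w = v \<bullet> w" .
qed

text \<open>The point is folded into the upper half plane by \<open>\<bar>b\<bar>\<close>, where an
  angle between 0 and \<open>pi\<close> exists; the sign of \<open>b\<close> then becomes the sign
  of the angle.\<close>

lemma polar_coordinates:
  fixes x :: "real^2"
  obtains t where "\<bar>t\<bar> \<le> pi" and "x = polar (norm x) t"
proof (cases "x = 0")
  case True
  then show thesis
    using that[of 0] by (simp add: vec_eq_iff forall_2)
next
  case False
  define a b where "a = x$1 / norm x" and "b = x$2 / norm x"
  have "(norm x)\<^sup>2 = (x$1)\<^sup>2 + (x$2)\<^sup>2"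
    unfolding power2_norm_eq_inner by (simp add: inner_vec_def sum_2 power2_eq_square)
  moreover have "a\<^sup>2 + \<bar>b\<bar>\<^sup>2 = ((x$1)\<^sup>2 + (x$2)\<^sup>2) / (norm x)\<^sup>2"
    by (simp add: a_def b_def power_divide add_divide_distrib)
  ultimately have "a\<^sup>2 + \<bar>b\<bar>\<^sup>2 = (norm x)\<^sup>2 / (norm x)\<^sup>2"
    by (simp only:)
  with False have "a\<^sup>2 + \<bar>b\<bar>\<^sup>2 = 1"
    by simp
  then obtain s where s: "0 \<le> s" "s \<le> pi" "a = cos s" "\<bar>b\<bar> = sin s"
    using sincos_total_pi[of "\<bar>b\<bar>" a] by auto
  define t where "t = (if 0 \<le> b then s else - s)"
  have ab: "a = cos t" "b = sin t"
    using s by (auto simp: t_def)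
  have x: "x$1 = norm x * a" "x$2 = norm x * b"
    using False by (simp_all add: a_def b_def)
  show thesis
  proof (rule that)
    show "\<bar>t\<bar> \<le> pi" using s by (simp add: t_def)
    show "x = polar (norm x) t"
      using x ab by (simp add: vec_eq_iff forall_2)
  qed
qed

text \<open>\<open>cos\<close> is strictly decreasing on \<open>[0, pi]\<close>, so the bound on the
  angle becomes a strict inequality between continuous functions, which makes openness evident. For
  \<open>\<theta>\<^sub>0 = pi\<close> it describes the plane slit along the nonpositive first
  axis.\<close>

lemma sector_eq:
  assumes "0 < \<theta>\<^sub>0" "\<theta>\<^sub>0 \<le> pi"
  shows "sector \<theta>\<^sub>0 = {x. norm x * cos \<theta>\<^sub>0 < x$1}"
proof (intro equalityI subsetI)
  fix x assume "x \<in> sector \<theta>\<^sub>0"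
  then obtain r t where x: "x = polar r t" "0 < r" "\<bar>t\<bar> < \<theta>\<^sub>0"
    by (auto simp: sector_def)
  have "cos \<theta>\<^sub>0 < cos \<bar>t\<bar>"
    using x assms by (intro cos_monotone_0_pi) auto
  with x show "x \<in> {x. norm x * cos \<theta>\<^sub>0 < x$1}"
    by (simp add: norm_polar)
next
  fix x :: "real^2" assume "x \<in> {x. norm x * cos \<theta>\<^sub>0 < x$1}"
  then have lt: "norm x * cos \<theta>\<^sub>0 < x$1" by simp
  then have "x \<noteq> 0" by auto
  obtain t where t: "\<bar>t\<bar> \<le> pi" "x = polar (norm x) t"
    by (rule polar_coordinates)
  have "x$1 = norm x * cos t"
    using arg_cong[OF t(2), of "\<lambda>y. y$1"] by simp
  with lt \<open>x \<noteq> 0\<close> have "cos \<theta>\<^sub>0 < cos \<bar>t\<bar>"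
    by simp
  then have "\<bar>t\<bar> < \<theta>\<^sub>0"
    using cos_monotone_0_pi_le[of \<theta>\<^sub>0 "\<bar>t\<bar>"] assms t(1) by (cases "\<bar>t\<bar> < \<theta>\<^sub>0") auto
  with t(2) \<open>x \<noteq> 0\<close> show "x \<in> sector \<theta>\<^sub>0"
    unfolding sector_def by (metis (mono_tags, lifting) mem_Collect_eq zero_less_norm_iff)
qed

section \<open>Comparison in truncated sectors\<close>

lemma open_truncated_sector:
  assumes "0 < \<theta>\<^sub>0" "\<theta>\<^sub>0 \<le> pi"
  shows "open (truncated (sector \<theta>\<^sub>0) R)"
proof -
  have "truncated (sector \<theta>\<^sub>0) R = {x. norm x * cos \<theta>\<^sub>0 < x$1} \<inter> {x. norm x < R}"
    by (auto simp: truncated_def sector_eq[OF assms])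
  then show ?thesis
    by (auto intro!: open_Int open_Collect_less continuous_intros)
qed

lemma bounded_truncated: "bounded (truncated \<Omega> R)"
  by (rule bounded_subset[OF bounded_ball[of 0 R]]) (auto simp: truncated_def)

text \<open>The sign \<open>\<sigma>\<close> selects the half of the sector containing the angle \<open>\<theta> = 2 * \<sigma> * a\<close>, and \<open>S\<close> is
  the part of the sector beyond the bisector of the angles \<open>0\<close> and \<open>\<theta>\<close>. Cutting with the half plane
  \<open>0 < \<sigma> * x$2\<close> matters for reflex sectors, which meet the backward extension of the bisector.\<close>

lemma truncated_sector_comparison:
  assumes \<theta>0: "0 < \<theta>\<^sub>0" "\<theta>\<^sub>0 \<le> pi"
    and sol: "variational_solution (truncated (sector \<theta>\<^sub>0) R) u"
    and cont: "continuous_on (truncated (sector \<theta>\<^sub>0) R) u"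
    and \<sigma>: "\<sigma> = 1 \<or> \<sigma> = -1" and a: "0 < a" "2 * a < \<theta>\<^sub>0" and r: "0 < r" "r < R"
  shows "u (polar r (\<sigma> * (2 * a))) \<le> u (polar r 0)"
proof -
  let ?U = "truncated (sector \<theta>\<^sub>0) R"
  let ?\<rho> = "reflection (\<sigma> * a)"
  define S where "S = {x \<in> ?U. 0 < \<sigma> * x$2 \<and> 0 < \<sigma> * (x$2 * cos (\<sigma> * a) - x$1 * sin (\<sigma> * a))}"
  have \<sigma>2: "\<sigma> * (\<sigma> * y) = y" for y
    using \<sigma> by auto
  \<comment> \<open>Writing angles as \<open>\<sigma> * s\<close> treats both halves alike: the
    conditions of \<open>S\<close> become \<open>0 < sin s\<close> and
    \<open>0 < sin (s - a)\<close>, and the reflection sends \<open>s\<close> to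
    \<open>2 * a - s\<close>.\<close>
  have first: "\<sigma> * polar q (\<sigma> * s) $ 2 = q * sin s" for q s
    using \<sigma> by auto
  have second: "\<sigma> * (polar q (\<sigma> * s) $ 2 * cos (\<sigma> * a) - polar q (\<sigma> * s) $ 1 * sin (\<sigma> * a)) = q * sin (s - a)" for q s
    using \<sigma> by (auto simp: sin_diff algebra_simps)
  have refl: "?\<rho> (polar q (\<sigma> * s)) = polar q (\<sigma> * (2 * a - s))" for q s
    by (simp add: reflection_polar algebra_simps)
  have polarU: "polar q (\<sigma> * s) \<in> ?U" if "0 < q" "q < R" "\<bar>s\<bar> < \<theta>\<^sub>0" for q s
  proof -
    have "\<bar>\<sigma> * s\<bar> < \<theta>\<^sub>0" using \<sigma> that(3) by auto
    with that show ?thesis by (auto simp: truncated_def norm_polar sector_def)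
  qed
  have Upolar: "\<exists>q s. x = polar q (\<sigma> * s) \<and> 0 < q \<and> q < R \<and> \<bar>s\<bar> < \<theta>\<^sub>0" if "x \<in> ?U" for x
  proof -
    from that obtain q t where "x = polar q t" "0 < q" "q < R" "\<bar>t\<bar> < \<theta>\<^sub>0"
      by (auto simp: truncated_def sector_def norm_polar)
    moreover have "\<bar>\<sigma> * t\<bar> < \<theta>\<^sub>0" using \<sigma> \<open>\<bar>t\<bar> < \<theta>\<^sub>0\<close> by auto
    ultimately show ?thesis
      by (intro exI[of _ q] exI[of _ "\<sigma> * t"]) (simp add: \<sigma>2)
  qed
  have "u (polar r (\<sigma> * (2 * a))) \<le> u (?\<rho> (polar r (\<sigma> * (2 * a))))"
  proof (rule reflection_comparison[OF sol open_truncated_sector[OF \<theta>0] bounded_truncated cont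
        orthogonal_reflection reflection_involution distr_lborel_orthogonal[OF orthogonal_reflection], of S])
    have "S = ?U \<inter> {x. 0 < \<sigma> * x$2} \<inter> {x. 0 < \<sigma> * (x$2 * cos (\<sigma> * a) - x$1 * sin (\<sigma> * a))}"
      by (auto simp: S_def)
    then show "open S"
      by (auto intro!: open_Int open_truncated_sector[OF \<theta>0] open_Collect_less continuous_intros)
    show "S \<subseteq> ?U" by (auto simp: S_def)
    show "?\<rho> ` S \<subseteq> ?U"
    proof clarify
      fix x assume x: "x \<in> S"
      then obtain q s where q: "x = polar q (\<sigma> * s)" "0 < q" "q < R" "\<bar>s\<bar> < \<theta>\<^sub>0"
        using Upolar[of x] by (auto simp: S_def)
      \<comment> \<open>As \<open>\<bar>s\<bar> < \<theta>\<^sub>0 \<le> pi\<close>, these signs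
        force \<open>a < s\<close>. The reflected angle \<open>2 * a - s\<close> then lies between
        \<open>2 * a - \<theta>\<^sub>0\<close> and \<open>a\<close>, inside the opening.\<close>
      have pos: "0 < sin s" "0 < sin (s - a)"
        using x q(2) unfolding S_def mem_Collect_eq q(1) first second by (auto simp: zero_less_mult_iff)
      have "0 < s"
        using pos(1) sin_ge_zero[of "- s"] q(4) \<theta>0(2) by (cases "0 < s") auto
      moreover have "a < s"
        using pos(2) sin_ge_zero[of "a - s"] a \<theta>0(2) \<open>0 < s\<close> sin_minus[of "s - a"] by (cases "a < s") auto
      ultimately show "?\<rho> x \<in> ?U"
        unfolding q(1) refl using q a by (intro polarU) auto
    qed
    show "closure S \<inter> ?U \<subseteq> S \<union> {x. ?\<rho> x = x}"
    proof
      fix x assume x: "x \<in> closure S \<inter> ?U"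
      have "closed {x::real^2. 0 \<le> \<sigma> * x$2 \<and> 0 \<le> \<sigma> * (x$2 * cos (\<sigma> * a) - x$1 * sin (\<sigma> * a))}"
        by (intro closed_Collect_conj closed_Collect_le continuous_intros)
      then have "closure S \<subseteq> {x. 0 \<le> \<sigma> * x$2 \<and> 0 \<le> \<sigma> * (x$2 * cos (\<sigma> * a) - x$1 * sin (\<sigma> * a))}"
        by (rule closure_minimal[rotated]) (auto simp: S_def)
      with x have le: "0 \<le> \<sigma> * x$2" "0 \<le> \<sigma> * (x$2 * cos (\<sigma> * a) - x$1 * sin (\<sigma> * a))"
        by auto
      obtain q s where q: "x = polar q (\<sigma> * s)" "0 < q" "q < R" "\<bar>s\<bar> < \<theta>\<^sub>0"
        using Upolar[of x] x by auto
      have pos: "0 \<le> sin s" "0 \<le> sin (s - a)"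
        using le q(2) unfolding q(1) first second by (auto simp: zero_le_mult_iff)
      \<comment> \<open>The weak inequality \<open>0 \<le> sin s\<close> would admit the axis of the
        sector; the second one rules it out, since \<open>sin (- a) < 0\<close>. Inside
        \<open>?U\<close> the boundary of \<open>S\<close> is thus confined to the bisector
        \<open>s = a\<close>.\<close>
      have "s \<noteq> 0"
        using pos(2) sin_gt_zero[of a] a \<theta>0(2) by auto
      moreover have "0 \<le> s"
        using pos(1) sin_gt_zero[of "- s"] q(4) \<theta>0(2) by (cases "0 \<le> s") auto
      ultimately have s: "0 < s" by simp
      then have sin_s: "0 < sin s"
        using q(4) \<theta>0(2) by (intro sin_gt_zero) auto
      have "a \<le> s"
        using pos(2) sin_gt_zero[of "a - s"] a \<theta>0(2) s sin_minus[of "s - a"] by (cases "a \<le> s") auto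
      show "x \<in> S \<union> {x. ?\<rho> x = x}"
      proof (cases "s = a")
        case True
        then show ?thesis unfolding q(1) using refl[of q s] by simp
      next
        case False
        with \<open>a \<le> s\<close> have "0 < sin (s - a)"
          using q(4) \<theta>0(2) a by (intro sin_gt_zero) auto
        then have "x \<in> S"
          using x sin_s q(2) unfolding S_def mem_Collect_eq q(1) first second by simp
        then show ?thesis ..
      qed
    qed
    have "0 < sin (2 * a)" "0 < sin (2 * a - a)"
      using a \<theta>0(2) by (auto intro!: sin_gt_zero)
    then show "polar r (\<sigma> * (2 * a)) \<in> S"
      unfolding S_def mem_Collect_eq first second
      using polarU[OF r, of "2 * a"] a r by simp
  qed
  then show ?thesis
    by (simp add: refl)
qed

theorem corollary3p12:
  fixes \<theta>\<^sub>0 :: real and u :: "real^2 \<Rightarrow> real"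
  assumes "0 < \<theta>\<^sub>0" and "\<theta>\<^sub>0 \<le> pi"
    and "minimal_solution (sector \<theta>\<^sub>0) u"
  shows "\<forall>r>0. \<forall>\<theta>. \<bar>\<theta>\<bar> < \<theta>\<^sub>0 \<longrightarrow> u (polar r \<theta>) \<le> u (polar r 0)"
proof (intro allI impI)
  fix r \<theta> :: real assume r: "0 < r" and \<theta>: "\<bar>\<theta>\<bar> < \<theta>\<^sub>0"
  from assms(3) obtain U :: "real \<Rightarrow> real^2 \<Rightarrow> real" where
    U: "\<And>R. 0 < R \<Longrightarrow> variational_solution (truncated (sector \<theta>\<^sub>0) R) (U R)"
      "\<And>R. 0 < R \<Longrightarrow> continuous_on (truncated (sector \<theta>\<^sub>0) R) (U R)"
      "\<And>R x. 0 < R \<Longrightarrow> x \<notin> truncated (sector \<theta>\<^sub>0) R \<Longrightarrow> U R x = 0"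
    and u: "\<And>x. x \<in> sector \<theta>\<^sub>0 \<Longrightarrow> ereal (u x) = (SUP R\<in>{0<..}. ereal (U R x))"
    unfolding minimal_solution_def by metis
  have le: "U R (polar r \<theta>) \<le> U R (polar r 0)" if R: "0 < R" for R
  proof (cases "r < R \<and> \<theta> \<noteq> 0")
    case True
    \<comment> \<open>The angle is written in the form \<open>\<sigma> * (2 * a)\<close> with
      \<open>\<sigma> = sgn \<theta>\<close> and half-angle
      \<open>a = \<bar>\<theta>\<bar> / 2\<close>.\<close>
    have "U R (polar r (sgn \<theta> * (2 * (\<bar>\<theta>\<bar> / 2)))) \<le> U R (polar r 0)"
      using True \<theta> r
      by (intro truncated_sector_comparison[OF assms(1,2) U(1,2)[OF R]]) (auto simp: sgn_if)
    then show ?thesis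
      by (simp add: mult.commute[of "sgn \<theta>"] abs_mult_sgn)
  next
    case False
    then consider "\<theta> = 0" | "R \<le> r" by linarith
    then show ?thesis
    proof cases
      \<comment> \<open>Both points have norm \<open>r\<close>, so they lie outside the truncated
        sector, where \<open>U R\<close> is extended by zero.\<close>
      case 2
      then have "U R (polar r t) = 0" for t
        using r by (intro U(3)[OF R]) (simp add: truncated_def norm_polar)
      then show ?thesis by simp
    qed simp
  qed
  have "polar r t \<in> sector \<theta>\<^sub>0" if "\<bar>t\<bar> < \<theta>\<^sub>0" for t
    unfolding sector_def using r that by blast
  then have "polar r \<theta> \<in> sector \<theta>\<^sub>0" "polar r 0 \<in> sector \<theta>\<^sub>0"
    using \<theta> assms(1) by simp_all
  moreover have "(SUP R\<in>{0<..}. ereal (U R (polar r \<theta>))) \<le> (SUP R\<in>{0<..}. ereal (U R (polar r 0)))"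
    by (rule SUP_mono) (use le in auto)
  ultimately have "ereal (u (polar r \<theta>)) \<le> ereal (u (polar r 0))"
    by (simp only: u)
  then show "u (polar r \<theta>) \<le> u (polar r 0)"
    by simp
qed

end
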